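(* The Adem norm $\|\cdot\|_A$ is a multiplicative norm. More precisely, for any $\theta_1,\theta_2$ in the $\mathbb{Q}_2$-algebra $\mathcal{J}_2$ we have $\|\theta_1\theta_2\|_A=\|\theta_1\|_A\|\theta_2\|_A$.
   Context: $\mathbb{Z}_2$ is the ring of dyadic ($2$-adic) integers and $\mathbb{Q}_2$ its fraction field. $\mathbb{Z}_2[\xi_1,\dots,\xi_n]$ is graded by $\deg\xi_i=1$. $Jq$ is the $\mathbb{Z}_2$-algebra endomorphism with $Jq(1)=1$, $Jq(\xi_i)=\xi_i+\xi_i^2$. For $k\ge0$, $Jq^k$ is the linear map raising degree by $k$ obtained, on each degree $d$, by restricting $Jq$ to degree $d$ and projecting onto degree $d+k$; $Jq^0=1$. The dyadic Steenrod algebra $\mathcal{J}_2$ is the $\mathbb{Z}_2$-algebra generated under composition by the $Jq^k$, two elements being equal when they agree as operators on $\mathbb{Z}_2[\xi_1,\dots,\xi_n]$ for every $n$; here it is considered as a $\mathbb{Q}_2$-algebra, i.e. $\mathcal{J}_2\otimes_{\mathbb{Z}_2}\mathbb{Q}_2$. Let $\mathcal{J}_2^+$ be the two-sided ideal generated by $Jq^1,Jq^2$ in this $\mathbb{Q}_2$-algebra. The Adem norm is the $\mathcal{J}_2^+$-adic norm: $\|\theta\|_A=2^{-j}$, where $j\ge0$ is the largest integer with $\theta\in(\mathcal{J}_2^+)^j$ (with $(\mathcal{J}_2^+)^0$ the whole algebra), and $\|0\|_A=0$; in particular $\|Jq^1\|_A=\|Jq^2\|_A=\frac12$ and $\|q\|_A=1$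 for $0\neq q\in\mathbb{Q}_2$. *)

theory Defs
  imports
    "HOL-Computational_Algebra.Computational_Algebra"
    "HOL-Algebra.Algebra"
    "HOL-Algebra.Algebraic_Closure_Type"
    "HOL-Library.Multiset"
    "HOL-Library.Poly_Mapping"
begin

section \<open>Dyadic integers and dyadic numbers\<close>

text \<open>A dyadic integer is a compatible sequence of residues: an element of the inverse limit of
  the rings of integers modulo \<open>2 ^ n\<close>, each residue class being represented in \<open>{0..<2 ^ n}\<close>.\<close>

typedef dyadic_int =
  "{x :: nat \<Rightarrow> int. \<forall>n. x n \<in> {0..<2 ^ n} \<and> x (Suc n) mod 2 ^ n = x n}"
  morphisms residue Abs_dyadic_int
  by (rule exI[of _ "\<lambda>_. 0"]) auto

setup_lifting type_definition_dyadic_int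

lemma dyadic_reduce:
  fixes a :: int
  shows "a mod 2 ^ Suc n mod 2 ^ n = a mod 2 ^ n"
  by (rule mod_mod_cancel) (simp add: le_imp_power_dvd)

lemma residue_mod: "m \<le> n \<Longrightarrow> residue x n mod 2 ^ m = residue x m"
proof (induction n rule: dec_induct)
  case base
  have "residue x m \<in> {0..<2 ^ m}" using residue[of x] by blast
  thus ?case by simp
next
  case (step n)
  have "residue x (Suc n) mod 2 ^ n = residue x n" using residue[of x] by blast
  hence "residue x n mod 2 ^ m = residue x (Suc n) mod 2 ^ n mod 2 ^ m" by simp
  also have "\<dots> = residue x (Suc n) mod 2 ^ m"
    by (rule mod_mod_cancel) (simp add: le_imp_power_dvd step)
  finally show ?case using step.IH by simp
qed

instantiation dyadic_int :: comm_ring_1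
begin

lift_definition zero_dyadic_int :: dyadic_int is "\<lambda>_. 0" by auto

lift_definition one_dyadic_int :: dyadic_int is "\<lambda>n. 1 mod 2 ^ n"
  using dyadic_reduce[of 1] by auto

lift_definition plus_dyadic_int :: "dyadic_int \<Rightarrow> dyadic_int \<Rightarrow> dyadic_int"
  is "\<lambda>x y n. (x n + y n) mod 2 ^ n"
  by (auto simp only: mem_Collect_eq dyadic_reduce) (auto, metis mod_add_eq)

lift_definition uminus_dyadic_int :: "dyadic_int \<Rightarrow> dyadic_int"
  is "\<lambda>x n. (- x n) mod 2 ^ n"
  by (auto simp only: mem_Collect_eq dyadic_reduce) (auto, metis mod_minus_eq)

lift_definition minus_dyadic_int :: "dyadic_int \<Rightarrow> dyadic_int \<Rightarrow> dyadic_int"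
  is "\<lambda>x y n. (x n - y n) mod 2 ^ n"
  by (auto simp only: mem_Collect_eq dyadic_reduce) (auto, metis mod_diff_eq)

lift_definition times_dyadic_int :: "dyadic_int \<Rightarrow> dyadic_int \<Rightarrow> dyadic_int"
  is "\<lambda>x y n. (x n * y n) mod 2 ^ n"
  by (auto simp only: mem_Collect_eq dyadic_reduce) (auto, metis mod_mult_eq)

instance
proof
  fix a b c :: dyadic_int
  show "a * b * c = a * (b * c)"
    by transfer (auto simp: mod_simps mult_ac)
  show "a * b = b * a"
    by transfer (auto simp: mult_ac)
  show "1 * a = a"
    by (simp flip: residue_inject del: one_mod_2_pow_eq
        add: times_dyadic_int.rep_eq one_dyadic_int.rep_eq mod_mult_left_eq residue_mod fun_eq_iff)
  show "a + b + c = a + (b + c)"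
    by transfer (auto simp: mod_simps add_ac)
  show "a + b = b + a"
    by transfer (auto simp: add_ac)
  show "0 + a = a"
    by transfer auto
  show "- a + a = 0"
    by transfer (auto simp: mod_simps)
  show "a - b = a + - b"
    by transfer (auto simp: mod_simps)
  show "(a + b) * c = a * c + b * c"
    by transfer (auto simp: mod_simps algebra_simps)
  show "(0 :: dyadic_int) \<noteq> 1"
  proof
    assume "(0 :: dyadic_int) = 1"
    hence "residue 0 1 = residue 1 1" by simp
    thus False by (simp add: zero_dyadic_int.rep_eq one_dyadic_int.rep_eq)
  qed
qed

end

lemma dvd_two_powers_mult:
  fixes a b :: int
  assumes "\<not> 2 ^ m dvd a" "\<not> 2 ^ n dvd b"
  shows "\<not> 2 ^ (m + n) dvd a * b"
proof
  assume *: "2 ^ (m + n) dvd a * b"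
  have nz: "a \<noteq> 0" "b \<noteq> 0" using assms by auto
  have "multiplicity 2 a < m" "multiplicity 2 b < n"
    using assms by (meson multiplicity_dvd' not_le)+
  moreover have "multiplicity 2 (a * b) \<ge> m + n"
    using * nz by (intro multiplicity_geI) auto
  moreover have "multiplicity 2 (a * b) = multiplicity 2 a + multiplicity 2 b"
    using nz by (intro prime_elem_multiplicity_mult_distrib) auto
  ultimately show False by simp
qed

instance dyadic_int :: idom
proof
  fix a b :: dyadic_int
  assume "a \<noteq> 0" "b \<noteq> 0"
  then obtain m n where mn: "residue a m \<noteq> 0" "residue b n \<noteq> 0"
    by (metis residue_inject ext zero_dyadic_int.rep_eq)
  have "\<not> 2 ^ m dvd residue a (m + n)" "\<not> 2 ^ n dvd residue b (m + n)"
    using mn residue_mod[of m "m + n" a] residue_mod[of n "m + n" b]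
    by (auto simp: dvd_eq_mod_eq_0)
  hence "residue (a * b) (m + n) \<noteq> 0"
    using dvd_two_powers_mult by (auto simp: times_dyadic_int.rep_eq)
  thus "a * b \<noteq> 0" by (auto simp: zero_dyadic_int.rep_eq)
qed

type_synonym dyadic_num = "dyadic_int fract"


section \<open>Polynomials over the dyadic integers and the total operation Jq\<close>

text \<open>Polynomials in the variables \<open>\<xi>\<^sub>0, \<xi>\<^sub>1, \<dots>\<close> (numbered from 0). Every polynomial involves only
  finitely many of them, so this is the union over \<open>n\<close> of the rings in the first \<open>n\<close> variables
  (\<open>UN_dyadic_polys_in\<close> below), and two operators agree on all of these rings iff they are equal.\<close>

type_synonym monomial = "nat \<Rightarrow>\<^sub>0 nat"

type_synonym dyadic_poly = "monomial \<Rightarrow>\<^sub>0 dyadic_int"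

definition dyadic_polys_in :: "nat \<Rightarrow> dyadic_poly set" where
  "dyadic_polys_in n = {p. \<forall>m \<in> Poly_Mapping.keys p. Poly_Mapping.keys m \<subseteq> {..<n}}"

lemma UN_dyadic_polys_in: "(\<Union>n. dyadic_polys_in n) = UNIV"
proof -
  have "p \<in> (\<Union>n. dyadic_polys_in n)" for p :: dyadic_poly
  proof -
    have "finite (\<Union>m\<in>Poly_Mapping.keys p. Poly_Mapping.keys m)" by auto
    then obtain n where "(\<Union>m\<in>Poly_Mapping.keys p. Poly_Mapping.keys m) \<subseteq> {..<n}"
      by (meson finite_nat_iff_bounded)
    thus ?thesis by (auto simp: dyadic_polys_in_def)
  qed
  thus ?thesis by blast
qed

lemma agree_on_all_dyadic_polys_in_iff:
  "(\<forall>n. \<forall>p \<in> dyadic_polys_in n. f p = g p) \<longleftrightarrow> f = g"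
  using UN_dyadic_polys_in by (metis UNIV_I UN_E ext)

definition const_poly :: "dyadic_int \<Rightarrow> dyadic_poly" where
  "const_poly c = Poly_Mapping.single 0 c"

definition xi :: "nat \<Rightarrow> dyadic_poly" where
  "xi i = Poly_Mapping.single (Poly_Mapping.single i 1) 1"

definition mon_degree :: "monomial \<Rightarrow> nat" where
  "mon_degree m = (\<Sum>i\<in>Poly_Mapping.keys m. Poly_Mapping.lookup m i)"

lift_definition hom_part ::
    "nat \<Rightarrow> (monomial \<Rightarrow>\<^sub>0 'a :: zero) \<Rightarrow> (monomial \<Rightarrow>\<^sub>0 'a)"
  is "\<lambda>d p m. if mon_degree m = d then p m else 0"
  by (erule finite_subset[rotated]) auto

definition mon_Jq :: "monomial \<Rightarrow> dyadic_poly" where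
  "mon_Jq m = (\<Prod>i\<in>Poly_Mapping.keys m. (xi i + xi i ^ 2) ^ Poly_Mapping.lookup m i)"

text \<open>The algebra endomorphism with \<open>\<xi>\<^sub>i \<mapsto> \<xi>\<^sub>i + \<xi>\<^sub>i\<^sup>2\<close>, by substitution; see \<open>Jq_one\<close>,
  \<open>Jq_const\<close>, \<open>Jq_xi\<close>, \<open>Jq_add\<close> and \<open>Jq_mult\<close>.\<close>

definition Jq :: "dyadic_poly \<Rightarrow> dyadic_poly" where
  "Jq p = (\<Sum>m\<in>Poly_Mapping.keys p. const_poly (Poly_Mapping.lookup p m) * mon_Jq m)"

text \<open>The sum runs over the finitely many degrees \<open>d\<close> occurring in \<open>p\<close>.\<close>

definition Jq_pow :: "nat \<Rightarrow> dyadic_poly \<Rightarrow> dyadic_poly" where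
  "Jq_pow k p = (\<Sum>d\<in>mon_degree ` Poly_Mapping.keys p. hom_part (d + k) (Jq (hom_part d p)))"

lemma const_poly_simps:
  "const_poly 0 = 0" "const_poly 1 = 1" "const_poly (a + b) = const_poly a + const_poly b"
  "const_poly (a * b) = const_poly a * const_poly b"
  by (simp_all add: const_poly_def single_add mult_single)

lemma lookup_const_poly_mult: "Poly_Mapping.lookup (const_poly c * p) m = c * Poly_Mapping.lookup p m"
proof -
  have "Poly_Mapping.lookup (const_poly c * p) m = Poly_Mapping.lookup (Poly_Mapping.map ((*) c) p) m"
    unfolding const_poly_def by (simp add: mult_map_scale_conv_mult)
  thus ?thesis by (simp add: map.rep_eq when_def)
qed

lemma Jq_superset:
  assumes "finite A" "Poly_Mapping.keys p \<subseteq> A"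
  shows "Jq p = (\<Sum>m\<in>A. const_poly (Poly_Mapping.lookup p m) * mon_Jq m)"
  unfolding Jq_def using assms
  by (intro sum.mono_neutral_left) (auto simp: in_keys_iff const_poly_simps)

lemma Jq_zero: "Jq 0 = 0"
  by (simp add: Jq_def)

lemma Jq_add: "Jq (p + q) = Jq p + Jq q"
proof -
  let ?A = "Poly_Mapping.keys p \<union> Poly_Mapping.keys q"
  have "Jq (p + q) = (\<Sum>m\<in>?A. const_poly (Poly_Mapping.lookup (p + q) m) * mon_Jq m)"
    by (rule Jq_superset) (auto simp: keys_add)
  also have "\<dots> = Jq p + Jq q"
    by (simp add: Jq_superset[of ?A p] Jq_superset[of ?A q] lookup_add const_poly_simps
        distrib_right sum.distrib)
  finally show ?thesis .
qed

lemma Jq_scale: "Jq (const_poly c * p) = const_poly c * Jq p"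
proof -
  have "Jq (const_poly c * p) = (\<Sum>m\<in>Poly_Mapping.keys p. const_poly (Poly_Mapping.lookup (const_poly c * p) m) * mon_Jq m)"
    by (rule Jq_superset) (auto simp: in_keys_iff lookup_const_poly_mult)
  thus ?thesis
    by (simp add: lookup_const_poly_mult const_poly_simps Jq_def sum_distrib_left mult.assoc)
qed

lemma Jq_single: "Jq (Poly_Mapping.single m c) = const_poly c * mon_Jq m"
  by (cases "c = 0") (auto simp: Jq_def const_poly_simps)

lemma mon_Jq_superset:
  assumes "finite A" "Poly_Mapping.keys m \<subseteq> A"
  shows "mon_Jq m = (\<Prod>i\<in>A. (xi i + xi i ^ 2) ^ Poly_Mapping.lookup m i)"
  unfolding mon_Jq_def using assms by (intro prod.mono_neutral_left) (auto simp: in_keys_iff)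

lemma mon_Jq_add: "mon_Jq (m + m') = mon_Jq m * mon_Jq m'"
proof -
  let ?A = "Poly_Mapping.keys m \<union> Poly_Mapping.keys m'"
  have "mon_Jq (m + m') = (\<Prod>i\<in>?A. (xi i + xi i ^ 2) ^ Poly_Mapping.lookup (m + m') i)"
    by (rule mon_Jq_superset) (auto simp: keys_add)
  thus ?thesis
    by (simp add: mon_Jq_superset[of ?A m] mon_Jq_superset[of ?A m'] lookup_add power_add
        prod.distrib)
qed

lemma poly_single_induct [case_names single add]:
  fixes p :: dyadic_poly
  assumes "\<And>m c. P (Poly_Mapping.single m c)" "\<And>p q. P p \<Longrightarrow> P q \<Longrightarrow> P (p + q)"
  shows "P p"
proof (induction p rule: update_induct)
  case const
  show ?case using assms(1)[of 0 0] by simp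
next
  case (update f a b)
  have "Poly_Mapping.update a b f = f + Poly_Mapping.single a b"
    using update by (intro poly_mapping_eqI)
      (auto simp: lookup_update lookup_add lookup_single in_keys_iff when_def)
  thus ?case using update assms by simp
qed

lemma Jq_mult: "Jq (p * q) = Jq p * Jq q"
proof (induction p rule: poly_single_induct)
  case (single m c)
  show ?case
  proof (induction q rule: poly_single_induct)
    case (single m' c')
    show ?case by (simp add: mult_single Jq_single mon_Jq_add const_poly_simps mult_ac)
  next
    case (add p q)
    thus ?case by (simp add: Jq_add distrib_left)
  qed
next
  case (add p q)
  thus ?case by (simp add: Jq_add distrib_right)
qed

lemma Jq_const: "Jq (const_poly c) = const_poly c"
  by (simp add: const_poly_def Jq_single mon_Jq_def)

lemma Jq_one: "Jq 1 = 1"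
  using Jq_const[of 1] by (simp add: const_poly_simps)

lemma Jq_xi: "Jq (xi i) = xi i + xi i ^ 2"
proof -
  have "mon_Jq (Poly_Mapping.single i 1) = xi i + xi i ^ 2"
    by (simp add: mon_Jq_def)
  thus ?thesis by (subst xi_def) (simp add: Jq_single const_poly_simps)
qed

lemma hom_part_zero [simp]: "hom_part d 0 = 0"
  by transfer auto

lemma hom_part_add: "hom_part d (p + q :: dyadic_poly) = hom_part d p + hom_part d q"
  by (rule poly_mapping_eqI) (simp add: hom_part.rep_eq lookup_add)

lemma lookup_hom_part: "Poly_Mapping.lookup (hom_part d p) m = (if mon_degree m = d then Poly_Mapping.lookup p m else 0)"
  by transfer auto

lemma hom_part_scale: "hom_part d (const_poly c * p) = const_poly c * hom_part d p"
  by (rule poly_mapping_eqI) (simp add: lookup_hom_part lookup_const_poly_mult)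

lemma hom_part_eq_0: "d \<notin> mon_degree ` Poly_Mapping.keys p \<Longrightarrow> hom_part d p = 0"
  by (rule poly_mapping_eqI) (auto simp: lookup_hom_part in_keys_iff)

lemma Jq_pow_superset:
  assumes "finite D" "mon_degree ` Poly_Mapping.keys p \<subseteq> D"
  shows "Jq_pow k p = (\<Sum>d\<in>D. hom_part (d + k) (Jq (hom_part d p)))"
  unfolding Jq_pow_def using assms
  by (intro sum.mono_neutral_left) (auto simp: hom_part_eq_0 Jq_zero)

lemma Jq_pow_add: "Jq_pow k (p + q) = Jq_pow k p + Jq_pow k q"
proof -
  let ?D = "mon_degree ` Poly_Mapping.keys p \<union> mon_degree ` Poly_Mapping.keys q"
  have "mon_degree ` Poly_Mapping.keys (p + q) \<subseteq> ?D"
    using keys_add[of p q] by blast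
  thus ?thesis
    by (simp add: Jq_pow_superset[of ?D] hom_part_add Jq_add sum.distrib)
qed

lemma Jq_pow_scale: "Jq_pow k (const_poly c * p) = const_poly c * Jq_pow k p"
proof -
  let ?D = "mon_degree ` Poly_Mapping.keys p"
  have "Poly_Mapping.keys (const_poly c * p) \<subseteq> Poly_Mapping.keys p"
    by (auto simp: in_keys_iff lookup_const_poly_mult)
  hence "mon_degree ` Poly_Mapping.keys (const_poly c * p) \<subseteq> ?D"
    by blast
  thus ?thesis
    by (simp add: Jq_pow_superset[of ?D] hom_part_scale Jq_scale sum_distrib_left)
qed


lemma mon_degree_superset:
  assumes "finite A" "Poly_Mapping.keys m \<subseteq> A"
  shows "mon_degree m = (\<Sum>i\<in>A. Poly_Mapping.lookup m i)"
  unfolding mon_degree_def using assms by (intro sum.mono_neutral_left) (auto simp: in_keys_iff)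

lemma mon_degree_add: "mon_degree (m + m') = mon_degree m + mon_degree m'"
proof -
  let ?A = "Poly_Mapping.keys m \<union> Poly_Mapping.keys m'"
  have "mon_degree (m + m') = (\<Sum>i\<in>?A. Poly_Mapping.lookup (m + m') i)"
    by (rule mon_degree_superset) (auto simp: keys_add)
  thus ?thesis
    by (simp add: mon_degree_superset[of ?A m] mon_degree_superset[of ?A m'] lookup_add
        sum.distrib)
qed

definition has_low_term :: "monomial \<Rightarrow> dyadic_poly \<Rightarrow> bool" where
  "has_low_term m p \<longleftrightarrow> (\<exists>r. p = Poly_Mapping.single m 1 + r \<and>
     (\<forall>m' \<in> Poly_Mapping.keys r. mon_degree m < mon_degree m'))"

lemma has_low_term_mult:
  assumes "has_low_term m p" "has_low_term m' p'"
  shows "has_low_term (m + m') (p * p')"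
proof -
  from assms obtain r r' where
    r: "p = Poly_Mapping.single m 1 + r"
       "\<And>k. k \<in> Poly_Mapping.keys r \<Longrightarrow> mon_degree m < mon_degree k" and
    r': "p' = Poly_Mapping.single m' 1 + r'"
       "\<And>k. k \<in> Poly_Mapping.keys r' \<Longrightarrow> mon_degree m' < mon_degree k"
    unfolding has_low_term_def by blast
  define s where "s = Poly_Mapping.single m 1 * r' + r * Poly_Mapping.single m' 1 + r * r'"
  have "p * p' = Poly_Mapping.single (m + m') 1 + s"
    by (simp add: r(1) r'(1) s_def mult_single algebra_simps)
  moreover have "mon_degree (m + m') < mon_degree k" if k: "k \<in> Poly_Mapping.keys s" for k
  proof -
    let ?P = "\<lambda>a b. (a = m \<and> b \<in> Poly_Mapping.keys r') \<or>
         (a \<in> Poly_Mapping.keys r \<and> b = m') \<or>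
         (a \<in> Poly_Mapping.keys r \<and> b \<in> Poly_Mapping.keys r')"
    have "Poly_Mapping.keys s \<subseteq> Poly_Mapping.keys (Poly_Mapping.single m 1 * r') \<union>
        Poly_Mapping.keys (r * Poly_Mapping.single m' 1) \<union> Poly_Mapping.keys (r * r')"
      unfolding s_def by (intro order.trans[OF keys_add] Un_mono keys_add order.refl)
    moreover have "Poly_Mapping.keys (Poly_Mapping.single m 1 * r') \<subseteq> {a + b | a b. ?P a b}"
      by (rule order.trans[OF keys_mult]) (simp, blast)
    moreover have "Poly_Mapping.keys (r * Poly_Mapping.single m' 1) \<subseteq> {a + b | a b. ?P a b}"
      by (rule order.trans[OF keys_mult]) (simp, blast)
    moreover have "Poly_Mapping.keys (r * r') \<subseteq> {a + b | a b. ?P a b}"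
      by (rule order.trans[OF keys_mult]) blast
    ultimately have "k \<in> {a + b | a b. ?P a b}"
      using k by (meson UnE subsetD)
    then obtain a b where "k = a + b" "?P a b"
      by (elim CollectE exE conjE)
    thus ?thesis
      using r(2)[of a] r'(2)[of b] by (auto simp: mon_degree_add)
  qed
  ultimately show ?thesis unfolding has_low_term_def by blast
qed

lemma has_low_term_power:
  "has_low_term (Poly_Mapping.single i n) ((xi i + xi i ^ 2) ^ n)"
proof (induction n)
  case 0
  show ?case by (auto simp: has_low_term_def intro!: exI[of _ 0])
next
  case (Suc n)
  have deg: "mon_degree (Poly_Mapping.single i k) = k" for k
    by (cases "k = 0") (simp_all add: mon_degree_def)
  have "xi i ^ 2 = Poly_Mapping.single (Poly_Mapping.single i 2) 1"
    by (simp add: xi_def power2_eq_square mult_single numeral_2_eq_2 flip: single_add)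
  hence "has_low_term (Poly_Mapping.single i 1) (xi i + xi i ^ 2)"
    unfolding has_low_term_def by (auto simp: xi_def deg intro!: exI[of _ "xi i ^ 2"])
  from has_low_term_mult[OF this Suc] show ?case
    by (simp flip: single_add)
qed

lemma has_low_term_mon_Jq: "has_low_term m (mon_Jq m)"
proof (induction m rule: update_induct)
  case const
  show ?case by (auto simp: has_low_term_def mon_Jq_def intro!: exI[of _ 0])
next
  case (update f a b)
  have "Poly_Mapping.update a b f = f + Poly_Mapping.single a b"
    using update by (intro poly_mapping_eqI)
      (auto simp: lookup_update lookup_add lookup_single in_keys_iff when_def)
  moreover have "mon_Jq (Poly_Mapping.single a b) = (xi a + xi a ^ 2) ^ b"
    by (simp add: mon_Jq_superset[of "{a}"])
  ultimately show ?case
    using has_low_term_mult[OF update(3) has_low_term_power[of a b]] by (simp add: mon_Jq_add)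
qed

lemma Jq_pow_0: "Jq_pow 0 = id"
proof
  fix p
  show "Jq_pow 0 p = id p"
  proof (induction p rule: poly_single_induct)
    case (single m c)
    have hom_single: "hom_part d (Poly_Mapping.single m c') =
        (if d = mon_degree m then Poly_Mapping.single m c' else 0)" for d and c' :: dyadic_int
      by (rule poly_mapping_eqI) (auto simp: lookup_hom_part lookup_single when_def)
    obtain r where r: "mon_Jq m = Poly_Mapping.single m 1 + r"
        "\<forall>m' \<in> Poly_Mapping.keys r. mon_degree m < mon_degree m'"
      using has_low_term_mon_Jq unfolding has_low_term_def by blast
    have "hom_part (mon_degree m) r = 0"
      using r(2) by (intro hom_part_eq_0) auto
    hence low: "hom_part (mon_degree m) (mon_Jq m) = Poly_Mapping.single m 1"
      by (simp add: r(1) hom_part_add hom_single)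
    have "const_poly c * Poly_Mapping.single m 1 = Poly_Mapping.single m c"
      by (simp add: const_poly_def mult_single)
    hence "Jq_pow 0 (Poly_Mapping.single m c) = Poly_Mapping.single m c"
      by (subst Jq_pow_superset[of "{mon_degree m}"])
        (auto simp: hom_single Jq_single hom_part_scale low)
    thus ?case by simp
  next
    case (add p q)
    thus ?case by (simp add: Jq_pow_add)
  qed
qed

section \<open>The dyadic Steenrod algebra\<close>

inductive_set steenrod_ops :: "(dyadic_poly \<Rightarrow> dyadic_poly) set" where
  Jq_pow: "Jq_pow k \<in> steenrod_ops"
| add: "f \<in> steenrod_ops \<Longrightarrow> g \<in> steenrod_ops \<Longrightarrow> (\<lambda>p. f p + g p) \<in> steenrod_ops"
| scale: "f \<in> steenrod_ops \<Longrightarrow> (\<lambda>p. const_poly c * f p) \<in> steenrod_ops"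
| comp: "f \<in> steenrod_ops \<Longrightarrow> g \<in> steenrod_ops \<Longrightarrow> f \<circ> g \<in> steenrod_ops"

lemma steenrod_ops_one: "id \<in> steenrod_ops"
  using steenrod_ops.Jq_pow[of 0] by (simp add: Jq_pow_0)

lemma steenrod_ops_linear:
  assumes "f \<in> steenrod_ops"
  shows "f (p + q) = f p + f q" "f (const_poly c * p) = const_poly c * f p"
  using assms
  by (induction arbitrary: p q c)
    (simp_all add: Jq_pow_add Jq_pow_scale distrib_left mult.left_commute)

lemma const_poly_minus_one: "const_poly (- 1) = - 1"
proof -
  have "const_poly (- 1) + const_poly 1 = 0"
    by (simp flip: const_poly_simps(3) add: const_poly_simps(1))
  thus ?thesis by (simp add: const_poly_simps eq_neg_iff_add_eq_0)
qed

typedef dyadic_steenrod = steenrod_ops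
  morphisms steenrod_apply Abs_dyadic_steenrod
  using steenrod_ops_one by blast

setup_lifting type_definition_dyadic_steenrod

lift_definition Jq_op :: "nat \<Rightarrow> dyadic_steenrod" is Jq_pow
  by (rule steenrod_ops.Jq_pow)

lift_definition steenrod_scale :: "dyadic_int \<Rightarrow> dyadic_steenrod \<Rightarrow> dyadic_steenrod"
  is "\<lambda>c f p. const_poly c * f p"
  by (rule steenrod_ops.scale)

instantiation dyadic_steenrod :: ring_1
begin

lift_definition zero_dyadic_steenrod :: dyadic_steenrod is "\<lambda>_. 0"
  using steenrod_ops.scale[OF steenrod_ops_one, of 0] by (simp add: const_poly_simps)

lift_definition one_dyadic_steenrod :: dyadic_steenrod is id
  by (rule steenrod_ops_one)

lift_definition plus_dyadic_steenrod :: "dyadic_steenrod \<Rightarrow> dyadic_steenrod \<Rightarrow> dyadic_steenrod"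
  is "\<lambda>f g p. f p + g p"
  by (rule steenrod_ops.add)

lift_definition uminus_dyadic_steenrod :: "dyadic_steenrod \<Rightarrow> dyadic_steenrod"
  is "\<lambda>f p. - f p"
  by (drule steenrod_ops.scale[where c = "- 1"]) (simp add: const_poly_minus_one)

lift_definition minus_dyadic_steenrod :: "dyadic_steenrod \<Rightarrow> dyadic_steenrod \<Rightarrow> dyadic_steenrod"
  is "\<lambda>f g p. f p - g p"
  by (drule (1) steenrod_ops.add[OF _ steenrod_ops.scale[where c = "- 1"]])
    (simp add: const_poly_minus_one)

lift_definition times_dyadic_steenrod :: "dyadic_steenrod \<Rightarrow> dyadic_steenrod \<Rightarrow> dyadic_steenrod"
  is "\<lambda>f g. f \<circ> g"
  by (rule steenrod_ops.comp)

instance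
proof
  fix a b c :: dyadic_steenrod
  show "a * b * c = a * (b * c)"
    by transfer (simp add: comp_assoc)
  show "1 * a = a" "a * 1 = a"
    by (transfer, simp)+
  show "a + b + c = a + (b + c)" "a + b = b + a" "0 + a = a" "- a + a = 0" "a - b = a + - b"
    by (transfer, simp add: add_ac)+
  show "(a + b) * c = a * c + b * c"
    by transfer (simp add: fun_eq_iff)
  show "a * (b + c) = a * b + a * c"
    by transfer (simp add: fun_eq_iff steenrod_ops_linear)
  show "(0 :: dyadic_steenrod) \<noteq> 1"
    by transfer (metis id_apply zero_neq_one)
qed

end

lemma steenrod_scale_simps:
  "steenrod_scale (c + d) a = steenrod_scale c a + steenrod_scale d a"
  "steenrod_scale c (a + b) = steenrod_scale c a + steenrod_scale c b"
  "steenrod_scale (c * d) a = steenrod_scale c (steenrod_scale d a)"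
  "steenrod_scale 1 a = a"
  "steenrod_scale c a * b = steenrod_scale c (a * b)"
  "a * steenrod_scale c b = steenrod_scale c (a * b)"
proof -
  show "a * steenrod_scale c b = steenrod_scale c (a * b)"
    by transfer (rule ext, simp, erule steenrod_ops_linear(2))
qed (transfer; simp add: const_poly_simps algebra_simps fun_eq_iff)+


section \<open>Extension of scalars to the dyadic numbers\<close>

definition num_of_int :: "dyadic_int \<Rightarrow> dyadic_num" where
  "num_of_int c = Fraction_Field.Fract c 1"

lemma num_of_int_simps:
  "num_of_int 0 = 0" "num_of_int 1 = 1"
  "num_of_int (c + d) = num_of_int c + num_of_int d"
  "num_of_int (c * d) = num_of_int c * num_of_int d"
  by (simp_all add: num_of_int_def Zero_fract_def One_fract_def)

text \<open>The tensor product over the dyadic integers of the dyadic Steenrod algebra with the dyadic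
  numbers: a multiset of pairs \<open>(\<theta>, q)\<close> stands for the formal sum of the tensors of \<open>\<theta>\<close> and \<open>q\<close>, and
  \<open>tensor_rel\<close> is the congruence generated by bilinearity.\<close>

inductive tensor_rel ::
    "(dyadic_steenrod \<times> dyadic_num) multiset \<Rightarrow> (dyadic_steenrod \<times> dyadic_num) multiset \<Rightarrow> bool"
where
  refl: "tensor_rel A A"
| sym: "tensor_rel A B \<Longrightarrow> tensor_rel B A"
| trans: "tensor_rel A B \<Longrightarrow> tensor_rel B C \<Longrightarrow> tensor_rel A C"
| cong: "tensor_rel A B \<Longrightarrow> tensor_rel (A + C) (B + C)"
| add_left: "tensor_rel {#(a + b, q)#} {#(a, q), (b, q)#}"
| add_right: "tensor_rel {#(a, q + r)#} {#(a, q), (a, r)#}"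
| zero_left: "tensor_rel {#(0, q)#} {#}"
| zero_right: "tensor_rel {#(a, 0)#} {#}"
| balanced: "tensor_rel {#(steenrod_scale c a, q)#} {#(a, num_of_int c * q)#}"

lemma tensor_rel_add:
  assumes "tensor_rel A B" "tensor_rel C D"
  shows "tensor_rel (A + C) (B + D)"
proof (rule tensor_rel.trans)
  show "tensor_rel (A + C) (B + C)" by (intro tensor_rel.cong assms)
  show "tensor_rel (B + C) (B + D)"
    using tensor_rel.cong[OF assms(2), of B] by (simp only: add.commute)
qed

definition formal_neg ::
    "(dyadic_steenrod \<times> dyadic_num) multiset \<Rightarrow> (dyadic_steenrod \<times> dyadic_num) multiset" where
  "formal_neg A = image_mset (\<lambda>(a, q). (- a, q)) A"

definition formal_mult ::
    "(dyadic_steenrod \<times> dyadic_num) multiset \<Rightarrow> (dyadic_steenrod \<times> dyadic_num) multiset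
      \<Rightarrow> (dyadic_steenrod \<times> dyadic_num) multiset" where
  "formal_mult A B = (\<Sum>(a, q)\<in>#A. image_mset (\<lambda>(b, r). (a * b, q * r)) B)"

lemma formal_mult_simps [simp]:
  "formal_mult {#} B = {#}"
  "formal_mult A {#} = {#}"
  "formal_mult (A + A') B = formal_mult A B + formal_mult A' B"
  "formal_mult A (B + B') = formal_mult A B + formal_mult A B'"
  by (induction A) (auto simp: formal_mult_def)

lemma formal_mult_add_mset_rev:
  "formal_mult A (add_mset x B) = formal_mult A {#x#} + formal_mult A B"
  using formal_mult_simps(4)[of A "{#x#}" B] by simp

lemma formal_mult_add_mset_left:
  "formal_mult (add_mset x A) B = formal_mult {#x#} B + formal_mult A B"
  using formal_mult_simps(3)[of "{#x#}" A B] by simp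

lemma formal_mult_single: "formal_mult {#(a, q)#} {#(b, r)#} = {#(a * b, q * r)#}"
  by (simp add: formal_mult_def)

lemma tensor_rel_sum:
  assumes "\<And>x. tensor_rel (f x) (g x)"
  shows "tensor_rel (\<Sum>x\<in>#B. f x) (\<Sum>x\<in>#B. g x)"
  by (induction B) (auto intro: tensor_rel.refl tensor_rel_add assms)

lemma formal_mult_sum_right: "formal_mult A B = (\<Sum>x\<in>#B. formal_mult A {#x#})"
  by (induction B) (simp, subst formal_mult_add_mset_rev, simp)

lemma formal_mult_sum_left: "formal_mult A B = (\<Sum>x\<in>#A. formal_mult {#x#} B)"
  by (induction A) (simp, subst formal_mult_add_mset_left, simp)

lemma formal_mult_rel_left:
  assumes "tensor_rel A A'"
  shows "tensor_rel (formal_mult A B) (formal_mult A' B)"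
  using assms
proof induction
  case (cong A A' C)
  thus ?case by (simp add: tensor_rel.cong)
next
  case (add_left a b q)
  show ?case
  proof (subst (1 2) formal_mult_sum_right, rule tensor_rel_sum, clarify)
    fix c r
    show "tensor_rel (formal_mult {#(a + b, q)#} {#(c, r)#})
            (formal_mult {#(a, q), (b, q)#} {#(c, r)#})"
      using tensor_rel.add_left[of "a * c" "b * c" "q * r"]
      by (simp add: formal_mult_add_mset_left[of _ "{#_#}"] formal_mult_single distrib_right
          add_mset_commute)
  qed
next
  case (add_right a q q')
  show ?case
  proof (subst (1 2) formal_mult_sum_right, rule tensor_rel_sum, clarify)
    fix c r
    show "tensor_rel (formal_mult {#(a, q + q')#} {#(c, r)#})
            (formal_mult {#(a, q), (a, q')#} {#(c, r)#})"
      using tensor_rel.add_right[of "a * c" "q * r" "q' * r"]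
      by (simp add: formal_mult_add_mset_left[of _ "{#_#}"] formal_mult_single distrib_right
          add_mset_commute)
  qed
next
  case (zero_left q)
  have "tensor_rel (formal_mult {#(0, q)#} B) (\<Sum>x\<in>#B. {#})"
    using tensor_rel.zero_left
    by (subst formal_mult_sum_right, intro tensor_rel_sum) (auto simp: formal_mult_single)
  thus ?case by simp
next
  case (zero_right a)
  have "tensor_rel (formal_mult {#(a, 0)#} B) (\<Sum>x\<in>#B. {#})"
    using tensor_rel.zero_right
    by (subst formal_mult_sum_right, intro tensor_rel_sum) (auto simp: formal_mult_single)
  thus ?case by simp
next
  case (balanced c a q)
  show ?case
    by (subst (1 2) formal_mult_sum_right, rule tensor_rel_sum)
      (auto simp: formal_mult_single steenrod_scale_simps mult.assoc intro: tensor_rel.balanced)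
qed (rule tensor_rel.refl tensor_rel.sym tensor_rel.trans; assumption)+

lemma formal_mult_rel_right:
  assumes "tensor_rel B B'"
  shows "tensor_rel (formal_mult A B) (formal_mult A B')"
  using assms
proof induction
  case (cong A A' C)
  thus ?case by (simp add: tensor_rel.cong)
next
  case (add_left a b q)
  show ?case
  proof (subst (1 2) formal_mult_sum_left, rule tensor_rel_sum, clarify)
    fix c r
    show "tensor_rel (formal_mult {#(c, r)#} {#(a + b, q)#})
            (formal_mult {#(c, r)#} {#(a, q), (b, q)#})"
      using tensor_rel.add_left[of "c * a" "c * b" "r * q"]
      by (simp add: formal_mult_add_mset_rev[of _ _ "{#_#}"] formal_mult_single distrib_left
          add_mset_commute)
  qed
next
  case (add_right a q q')
  show ?case
  proof (subst (1 2) formal_mult_sum_left, rule tensor_rel_sum, clarify)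
    fix c r
    show "tensor_rel (formal_mult {#(c, r)#} {#(a, q + q')#})
            (formal_mult {#(c, r)#} {#(a, q), (a, q')#})"
      using tensor_rel.add_right[of "c * a" "r * q" "r * q'"]
      by (simp add: formal_mult_add_mset_rev[of _ _ "{#_#}"] formal_mult_single distrib_left
          add_mset_commute)
  qed
next
  case (zero_left q)
  have "tensor_rel (formal_mult A {#(0, q)#}) (\<Sum>x\<in>#A. {#})"
    using tensor_rel.zero_left
    by (subst formal_mult_sum_left, intro tensor_rel_sum) (auto simp: formal_mult_single)
  thus ?case by simp
next
  case (zero_right a)
  have "tensor_rel (formal_mult A {#(a, 0)#}) (\<Sum>x\<in>#A. {#})"
    using tensor_rel.zero_right
    by (subst formal_mult_sum_left, intro tensor_rel_sum) (auto simp: formal_mult_single)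
  thus ?case by simp
next
  case (balanced c a q)
  have "tensor_rel {#(b * steenrod_scale c a, r * q)#} {#(b * a, r * (num_of_int c * q))#}" for b r
    using tensor_rel.balanced[of c "b * a" "r * q"]
    by (simp add: steenrod_scale_simps mult.left_commute)
  thus ?case
    by (subst (1 2) formal_mult_sum_left, intro tensor_rel_sum) (auto simp: formal_mult_single)
qed (rule tensor_rel.refl tensor_rel.sym tensor_rel.trans; assumption)+

lemma formal_mult_rel:
  "tensor_rel A A' \<Longrightarrow> tensor_rel B B' \<Longrightarrow> tensor_rel (formal_mult A B) (formal_mult A' B')"
  by (rule tensor_rel.trans[OF formal_mult_rel_left formal_mult_rel_right])

lemma formal_mult_assoc:
  "formal_mult (formal_mult A B) C = formal_mult A (formal_mult B C)"
proof (induction A)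
  case (add x A)
  have "formal_mult (formal_mult {#x#} B) C = formal_mult {#x#} (formal_mult B C)"
  proof (induction B)
    case (add y B)
    have "formal_mult (formal_mult {#x#} {#y#}) C = formal_mult {#x#} (formal_mult {#y#} C)"
    proof (induction C)
      case (add z C)
      have "formal_mult (formal_mult {#x#} {#y#}) {#z#} =
              formal_mult {#x#} (formal_mult {#y#} {#z#})"
        by (cases x; cases y; cases z) (simp add: formal_mult_single mult.assoc)
      thus ?case
        by (simp only: formal_mult_add_mset_rev[of _ z C] formal_mult_simps add.IH)
    qed (simp only: formal_mult_simps)
    thus ?case
      by (simp only: formal_mult_add_mset_rev[of _ y B] formal_mult_add_mset_left[of y B]
          formal_mult_simps add.IH)
  qed (simp only: formal_mult_simps)
  thus ?case
    by (simp only: formal_mult_add_mset_left[of x A] formal_mult_simps add.IH)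
qed (simp only: formal_mult_simps)

lemma formal_mult_one: "formal_mult {#(1, 1)#} A = A" "formal_mult A {#(1, 1)#} = A"
  by (induction A) (auto simp: formal_mult_def)

lemma tensor_rel_neg_add: "tensor_rel (formal_neg A + A) {#}"
proof (induction A)
  case empty
  show ?case by (simp add: formal_neg_def tensor_rel.refl)
next
  case (add x A)
  obtain a q where x: "x = (a, q)" by (cases x)
  have "tensor_rel {#(- a, q), (a, q)#} {#}"
    using tensor_rel.trans[OF tensor_rel.sym[OF tensor_rel.add_left[of "- a" a q]]]
      tensor_rel.zero_left[of q] by simp
  from tensor_rel_add[OF this add] show ?case
    by (simp add: x formal_neg_def add_mset_commute)
qed

lemma formal_neg_rel:
  assumes "tensor_rel A B"
  shows "tensor_rel (formal_neg A) (formal_neg B)"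
proof -
  have "tensor_rel (formal_neg A + (formal_neg B + B)) (formal_neg A + {#})"
    by (intro tensor_rel_add tensor_rel.refl tensor_rel_neg_add)
  moreover have "tensor_rel (formal_neg A + (formal_neg B + B)) (formal_neg A + (formal_neg B + A))"
    by (intro tensor_rel_add tensor_rel.refl tensor_rel.sym[OF assms])
  moreover have "tensor_rel (formal_neg A + (formal_neg B + A)) (formal_neg B + {#})"
    using tensor_rel_add[OF tensor_rel.refl[of "formal_neg B"] tensor_rel_neg_add[of A]]
    by (simp add: add_ac)
  ultimately have "tensor_rel (formal_neg A + {#}) (formal_neg B + {#})"
    by (rule tensor_rel.trans[OF tensor_rel.sym tensor_rel.trans])
  thus ?thesis by simp
qed

text \<open>The value of a formal sum at the polynomial 1, used only to see that \<open>0 \<noteq> 1\<close>.\<close>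

definition formal_eval :: "(dyadic_steenrod \<times> dyadic_num) multiset \<Rightarrow> dyadic_num" where
  "formal_eval A =
     (\<Sum>(a, q)\<in>#A. num_of_int (Poly_Mapping.lookup (steenrod_apply a 1) 0) * q)"

lemma formal_eval_rel: "tensor_rel A B \<Longrightarrow> formal_eval A = formal_eval B"
  by (induction rule: tensor_rel.induct)
    (auto simp: formal_eval_def plus_dyadic_steenrod.rep_eq zero_dyadic_steenrod.rep_eq
      steenrod_scale.rep_eq lookup_add lookup_const_poly_mult num_of_int_simps algebra_simps)

quotient_type dyadic_steenrod_Q = "(dyadic_steenrod \<times> dyadic_num) multiset" / tensor_rel
  morphisms rep_tensor tensor_class
proof (rule equivpI)
  show "reflp tensor_rel" by (rule reflpI) (rule tensor_rel.refl)
  show "symp tensor_rel" by (rule sympI) (rule tensor_rel.sym)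
  show "transp tensor_rel" by (rule transpI) (rule tensor_rel.trans)
qed

lemma tensor_class_eq_iff: "tensor_class A = tensor_class B \<longleftrightarrow> tensor_rel A B"
  using Quotient_rel[OF Quotient_dyadic_steenrod_Q, of A B] by (simp add: tensor_rel.refl)

lemma tensor_rel_rep: "tensor_rel (rep_tensor (tensor_class A)) A"
  using Quotient_abs_rep[OF Quotient_dyadic_steenrod_Q] by (simp flip: tensor_class_eq_iff)

lemma tensor_class_cases [cases type]: obtains A where "x = tensor_class A"
  using Quotient_abs_rep[OF Quotient_dyadic_steenrod_Q] by metis

definition tensor :: "dyadic_steenrod \<Rightarrow> dyadic_num \<Rightarrow> dyadic_steenrod_Q" where
  "tensor \<theta> q = tensor_class {#(\<theta>, q)#}"

instantiation dyadic_steenrod_Q :: ring_1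
begin

definition "0 = tensor_class {#}"
definition "1 = tensor_class {#(1, 1)#}"
definition "x + y = tensor_class (rep_tensor x + rep_tensor y)"
definition "- x = tensor_class (formal_neg (rep_tensor x))"
definition "x - y = tensor_class (rep_tensor x + formal_neg (rep_tensor y))"
definition "x * y = tensor_class (formal_mult (rep_tensor x) (rep_tensor y))"

lemma tensor_class_arith:
  "tensor_class A + tensor_class B = tensor_class (A + B)"
  "- tensor_class A = tensor_class (formal_neg A)"
  "tensor_class A - tensor_class B = tensor_class (A + formal_neg B)"
  "tensor_class A * tensor_class B = tensor_class (formal_mult A B)"
  by (auto simp: plus_dyadic_steenrod_Q_def uminus_dyadic_steenrod_Q_def
      minus_dyadic_steenrod_Q_def times_dyadic_steenrod_Q_def tensor_class_eq_iff
      intro!: tensor_rel_add formal_neg_rel formal_mult_rel tensor_rel_rep)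

instance
proof
  fix x y z :: dyadic_steenrod_Q
  obtain A where x: "x = tensor_class A" by (rule tensor_class_cases)
  obtain B where y: "y = tensor_class B" by (rule tensor_class_cases)
  obtain C where z: "z = tensor_class C" by (rule tensor_class_cases)
  note defs = x y z zero_dyadic_steenrod_Q_def one_dyadic_steenrod_Q_def tensor_class_arith
  show "x * y * z = x * (y * z)"
    by (simp add: defs formal_mult_assoc)
  show "1 * x = x" "x * 1 = x"
    by (simp_all add: defs formal_mult_one)
  show "x + y + z = x + (y + z)" "x + y = y + x" "0 + x = x" "x - y = x + - y"
    by (simp_all add: defs add_ac)
  show "- x + x = 0"
    by (simp add: defs tensor_class_eq_iff tensor_rel_neg_add)
  show "(x + y) * z = x * z + y * z" "x * (y + z) = x * y + x * z"
    by (simp_all add: defs)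
  show "(0 :: dyadic_steenrod_Q) \<noteq> 1"
  proof
    assume "(0 :: dyadic_steenrod_Q) = 1"
    hence "tensor_rel {#} {#(1, 1)#}"
      by (simp add: defs tensor_class_eq_iff)
    from formal_eval_rel[OF this] show False
      by (simp add: formal_eval_def one_dyadic_steenrod.rep_eq num_of_int_simps)
  qed
qed

end

lemma tensor_simps:
  "tensor (a + b) q = tensor a q + tensor b q"
  "tensor a (q + r) = tensor a q + tensor a r"
  "tensor (steenrod_scale c a) q = tensor a (num_of_int c * q)"
  "tensor a q * tensor b r = tensor (a * b) (q * r)"
  "1 = tensor 1 1"
  using tensor_rel.add_left[of a b q] tensor_rel.add_right[of a q r] tensor_rel.balanced[of c a q]
  by (simp_all add: tensor_def tensor_class_arith tensor_class_eq_iff formal_mult_single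
      one_dyadic_steenrod_Q_def add_mset_commute)


section \<open>The Adem norm\<close>

abbreviation steenrod_Q_ring :: "dyadic_steenrod_Q ring" where
  "steenrod_Q_ring \<equiv> ring_of_type_algebra"

lemma ring_steenrod_Q_ring: "ring steenrod_Q_ring"
proof (rule ringI)
  have "\<exists>y. y + x = 0" for x :: dyadic_steenrod_Q
    by (rule exI[of _ "- x"]) (rule left_minus)
  thus "abelian_group steenrod_Q_ring"
    by (intro abelian_groupI) (simp_all add: ring_of_type_algebra_def add_ac)
  show "Group.monoid steenrod_Q_ring"
    by (intro monoidI) (simp_all add: ring_of_type_algebra_def mult.assoc)
qed (simp_all add: ring_of_type_algebra_def distrib_left distrib_right)

text \<open>Ideals of the ring are automatically closed under scalars from the dyadic numbers, since
  these sit inside it as the elements \<open>tensor 1 q\<close>.\<close>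

definition J_plus :: "dyadic_steenrod_Q set" where
  "J_plus = genideal steenrod_Q_ring {tensor (Jq_op 1) 1, tensor (Jq_op 2) 1}"

text \<open>Powers with respect to the product of ideals; the 0th power is the whole algebra.\<close>

definition J_plus_power :: "nat \<Rightarrow> dyadic_steenrod_Q set" where
  "J_plus_power j = J_plus [^]\<^bsub>ideals_set steenrod_Q_ring\<^esub> j"

lemma J_plus_power_simps:
  "J_plus_power 0 = UNIV"
  "J_plus_power (Suc j) = ideal_prod steenrod_Q_ring (J_plus_power j) J_plus"
  by (simp_all add: J_plus_power_def nat_pow_def ideals_set_def ring_of_type_algebra_def)

text \<open>The usual convention for adic norms: an element of all powers has norm 0. That 0 is the only
  such element is part of the assertion that this is a norm.\<close>

definition adem_norm :: "dyadic_steenrod_Q \<Rightarrow> real" where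
  "adem_norm \<theta> =
     (if \<forall>j. \<theta> \<in> J_plus_power j then 0 else (1 / 2) ^ (GREATEST j. \<theta> \<in> J_plus_power j))"

definition multiplicative_norm :: "('a :: ring_1 \<Rightarrow> real) \<Rightarrow> bool" where
  "multiplicative_norm N \<longleftrightarrow>
     (\<forall>x. N x \<ge> 0) \<and> (\<forall>x. N x = 0 \<longleftrightarrow> x = 0) \<and>
     (\<forall>x y. N (x + y) \<le> N x + N y) \<and> (\<forall>x y. N (x * y) = N x * N y)"

end

theory Submission
  imports Defs "HOL-Library.Multiset_Order" "HOL-Library.Product_Lexorder"
begin

text \<open>Over the dyadic numbers the algebra is the enveloping algebra of the Lie algebra spanned by the
  derivations \<open>L\<^sub>k = (\<Sum>i. \<xi>\<^sub>i ^ (k + 2) \<partial>\<^sub>i)\<close>, \<open>k \<ge> 0\<close>, with \<open>[L\<^sub>i, L\<^sub>j] = (j - i) L\<^bsub>i+j+1\<^esub>\<close>. Indeed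
  \<open>Jq\<^sup>1 = L\<^sub>0\<close> and \<open>Jq\<^sup>2 = L\<^sub>0\<^sup>2 / 2 - L\<^sub>1\<close>, the brackets of \<open>L\<^sub>0\<close> and \<open>L\<^sub>1\<close> give all \<open>L\<^sub>k\<close>, and every \<open>Jq\<^sup>n\<close> is a
  polynomial in them. Give \<open>L\<^sub>k\<close> the weight \<open>max 1 k\<close>, its position in the lower central series. Ordered
  monomials in the \<open>L\<^sub>k\<close> form a basis, and the \<open>j\<close>-th power of the ideal is spanned by those of weight
  at least \<open>j\<close>. Exchanging two factors only produces shorter monomials of at least the same weight;
  so, ordering monomials by weight first and then by decreasing length, leading monomials multiply as
  commutative monomials do, and the minimal weight of a monomial in \<open>x * y\<close> is the sum of those of
  \<open>x\<close> and \<open>y\<close>.\<close>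

section \<open>Characteristic zero, and induction on polynomials\<close>

lemma residue_of_nat: "residue (of_nat n) k = int n mod 2 ^ k"
  by (induction n)
    (simp_all add: zero_dyadic_int.rep_eq one_dyadic_int.rep_eq plus_dyadic_int.rep_eq mod_simps)

instance dyadic_int :: ring_char_0
proof
  show "inj (of_nat :: nat \<Rightarrow> dyadic_int)"
  proof (rule injI)
    fix m n :: nat
    assume eq: "(of_nat m :: dyadic_int) = of_nat n"
    \<comment> \<open>The modulus \<open>2 ^ (m + n)\<close> exceeds both numbers, so at this level
      each is its own residue.\<close>
    have "int m mod 2 ^ (m + n) = int n mod 2 ^ (m + n)"
      using arg_cong[OF eq, of "\<lambda>x. residue x (m + n)"] by (simp add: residue_of_nat)
    moreover have "int m < 2 ^ (m + n)" "int n < 2 ^ (m + n)"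
      using of_nat_less_two_power[of "m + n", where 'a = int] by linarith+
    ultimately show "m = n" by simp
  qed
qed

lemma xi_power: "xi i ^ n = Poly_Mapping.single (Poly_Mapping.single i n) 1"
  by (induction n) (simp_all add: xi_def mult_single flip: single_add)

lemma single_eq_const_poly_mult:
  "Poly_Mapping.single m c = const_poly c * Poly_Mapping.single m 1"
  by (simp add: const_poly_def mult_single)

text \<open>Constants and variables generate the polynomial ring, so statements compatible with sums
  and products reduce to the variables.\<close>

lemma dyadic_poly_induct [case_names const xi add mult]:
  fixes p :: dyadic_poly
  assumes const: "\<And>c. P (const_poly c)" and xi: "\<And>i. P (xi i)"
    and add: "\<And>p q. P p \<Longrightarrow> P q \<Longrightarrow> P (p + q)"
    and mult: "\<And>p q. P p \<Longrightarrow> P q \<Longrightarrow> P (p * q)"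
  shows "P p"
proof (induction p rule: poly_single_induct)
  case (single m c)
  have pow: "P (xi i ^ n)" for i n
    using const[of 1] by (induction n) (simp_all add: const_poly_simps xi mult)
  have "P (Poly_Mapping.single m 1)"
  proof (induction m rule: update_induct)
    case const
    show ?case using assms(1)[of 1] by (simp add: const_poly_simps)
  next
    case (update f a b)
    have "Poly_Mapping.update a b f = f + Poly_Mapping.single a b"
      using update by (intro poly_mapping_eqI)
        (auto simp: lookup_update lookup_add lookup_single in_keys_iff when_def)
    hence "Poly_Mapping.single (Poly_Mapping.update a b f) 1 = Poly_Mapping.single f 1 * xi a ^ b"
      by (simp add: xi_power mult_single)
    thus ?case using mult[OF update(3) pow] by simp
  qed
  thus ?case
    by (subst single_eq_const_poly_mult) (intro mult const)
qed (rule add)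

section \<open>The derivations\<close>

text \<open>Differentiation lowers an exponent by one and the factor
  \<open>\<xi>\<^sub>i ^ (k + 2)\<close> raises it by \<open>k + 2\<close>; hence the net shift
  \<open>Suc k\<close>.\<close>

definition mon_witt_op :: "nat \<Rightarrow> monomial \<Rightarrow> dyadic_poly" where
  "mon_witt_op k m = (\<Sum>i\<in>Poly_Mapping.keys m.
     Poly_Mapping.single (m + Poly_Mapping.single i (Suc k)) (of_nat (Poly_Mapping.lookup m i)))"

definition witt_op :: "nat \<Rightarrow> dyadic_poly \<Rightarrow> dyadic_poly" where
  "witt_op k p = (\<Sum>m\<in>Poly_Mapping.keys p. const_poly (Poly_Mapping.lookup p m) * mon_witt_op k m)"

lemma witt_op_superset:
  assumes "finite A" "Poly_Mapping.keys p \<subseteq> A"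
  shows "witt_op k p = (\<Sum>m\<in>A. const_poly (Poly_Mapping.lookup p m) * mon_witt_op k m)"
  unfolding witt_op_def using assms
  by (intro sum.mono_neutral_left) (auto simp: in_keys_iff const_poly_simps)

lemma witt_op_add: "witt_op k (p + q) = witt_op k p + witt_op k q"
proof -
  let ?A = "Poly_Mapping.keys p \<union> Poly_Mapping.keys q"
  have "witt_op k (p + q) = (\<Sum>m\<in>?A. const_poly (Poly_Mapping.lookup (p + q) m) * mon_witt_op k m)"
    by (rule witt_op_superset) (auto simp: keys_add)
  thus ?thesis
    by (simp add: witt_op_superset[of ?A p] witt_op_superset[of ?A q] lookup_add const_poly_simps
        distrib_right sum.distrib)
qed

lemma witt_op_single: "witt_op k (Poly_Mapping.single m c) = const_poly c * mon_witt_op k m"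
  by (cases "c = 0") (auto simp: witt_op_def const_poly_simps)

lemma mon_witt_op_superset:
  assumes "finite A" "Poly_Mapping.keys m \<subseteq> A"
  shows "mon_witt_op k m = (\<Sum>i\<in>A.
     Poly_Mapping.single (m + Poly_Mapping.single i (Suc k)) (of_nat (Poly_Mapping.lookup m i)))"
  unfolding mon_witt_op_def using assms by (intro sum.mono_neutral_left) (auto simp: in_keys_iff)

lemma mon_witt_op_add:
  "mon_witt_op k (m + m') = Poly_Mapping.single m' 1 * mon_witt_op k m +
     Poly_Mapping.single m 1 * mon_witt_op k m'"
proof -
  let ?A = "Poly_Mapping.keys m \<union> Poly_Mapping.keys m'"
  have "mon_witt_op k (m + m') = (\<Sum>i\<in>?A. Poly_Mapping.single (m + m' + Poly_Mapping.single i (Suc k))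
      (of_nat (Poly_Mapping.lookup (m + m') i)))"
    by (rule mon_witt_op_superset) (auto simp: keys_add)
  thus ?thesis
    by (simp add: mon_witt_op_superset[of ?A m] mon_witt_op_superset[of ?A m'] lookup_add sum_distrib_left
        mult_single single_add add_ac flip: sum.distrib)
qed

lemma witt_op_mult: "witt_op k (p * q) = witt_op k p * q + p * witt_op k q"
proof (induction p rule: poly_single_induct)
  case (single m c)
  show ?case
  proof (induction q rule: poly_single_induct)
    case (single m' c')
    show ?case
      by (simp add: mult_single witt_op_single mon_witt_op_add)
        (simp add: single_eq_const_poly_mult[of m c] single_eq_const_poly_mult[of m' c']
          const_poly_simps algebra_simps)
  next
    case (add p q)
    thus ?case by (simp add: witt_op_add algebra_simps)
  qed
next
  case (add p q)
  thus ?case by (simp add: witt_op_add algebra_simps)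
qed

lemma witt_op_const: "witt_op k (const_poly c) = 0"
  by (simp add: const_poly_def witt_op_single mon_witt_op_def)

lemma witt_op_zero: "witt_op k 0 = 0"
  by (simp add: witt_op_def)

lemma witt_op_xi: "witt_op k (xi i) = xi i ^ (k + 2)"
  by (subst xi_power, subst xi_def)
    (simp add: witt_op_single mon_witt_op_def const_poly_simps flip: single_add)

lemma witt_op_one: "witt_op k 1 = 0"
  using witt_op_const[of k 1] by (simp add: const_poly_simps)

lemma witt_op_power: "witt_op k (p ^ n) = of_nat n * p ^ (n - 1) * witt_op k p"
proof (induction n)
  case (Suc n)
  thus ?case by (cases n) (simp_all add: witt_op_mult algebra_simps)
qed (simp add: witt_op_one)

lemma const_poly_of_int: "const_poly (of_int n) = of_int n"
proof -
  have nat: "const_poly (of_nat n) = of_nat n" for n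
    by (induction n) (simp_all add: const_poly_simps)
  have "const_poly (- of_nat n) = - of_nat n" for n
    using const_poly_simps(3)[of "- of_nat n" "of_nat n"]
    by (simp add: const_poly_simps nat eq_neg_iff_add_eq_0)
  thus ?thesis by (cases n) (simp_all add: nat del: of_nat_Suc)
qed

text \<open>A commutator of derivations is a derivation, so the variables decide: there the two
  compositions give the same power with coefficients \<open>j + 2\<close> and
  \<open>i + 2\<close>.\<close>

lemma witt_op_commutator:
  "witt_op i (witt_op j p) - witt_op j (witt_op i p) = of_int (int j - int i) * witt_op (i + j + 1) p"
proof (induction p rule: dyadic_poly_induct)
  case (xi l)
  have "witt_op i (witt_op j (xi l)) = of_nat (j + 2) * xi l ^ (i + j + 3)" for i j
  proof -
    have e: "j + 2 - 1 + (i + 2) = i + j + 3" by simp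
    show ?thesis by (simp only: witt_op_xi witt_op_power mult.assoc e flip: power_add)
  qed
  hence "witt_op i (witt_op j (xi l)) - witt_op j (witt_op i (xi l)) =
      of_nat (j + 2) * xi l ^ (i + j + 3) - of_nat (i + 2) * xi l ^ (i + j + 3)"
    by (simp only: add.commute[of j i])
  also have "\<dots> = of_int (int j - int i) * xi l ^ (i + j + 3)"
    by (simp only: flip: left_diff_distrib) simp
  finally show ?case by (simp only: witt_op_xi) (simp add: eval_nat_numeral)
next
  case (mult p q)
  \<comment> \<open>Mixed terms such as \<open>witt_op i p * witt_op j q\<close> occur in both
    compositions and cancel.\<close>
  have "witt_op i (witt_op j (p * q)) - witt_op j (witt_op i (p * q)) =
      (witt_op i (witt_op j p) - witt_op j (witt_op i p)) * q +
      p * (witt_op i (witt_op j q) - witt_op j (witt_op i q))"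
    by (simp add: witt_op_mult witt_op_add algebra_simps)
  thus ?case unfolding mult by (simp add: witt_op_mult algebra_simps)
next
  case (add p q)
  have "witt_op i (witt_op j (p + q)) - witt_op j (witt_op i (p + q)) =
      (witt_op i (witt_op j p) - witt_op j (witt_op i p)) +
      (witt_op i (witt_op j q) - witt_op j (witt_op i q))"
    by (simp add: witt_op_add)
  thus ?case unfolding add by (simp add: witt_op_add distrib_left)
qed (simp add: witt_op_const witt_op_zero)

section \<open>The Cartan formula and a recursion for the components of Jq\<close>

lemma hom_part_single:
  "hom_part d (Poly_Mapping.single m c) = (if d = mon_degree m then Poly_Mapping.single m c else 0)"
  for c :: dyadic_int
  by (rule poly_mapping_eqI) (auto simp: lookup_hom_part lookup_single when_def)

lemma hom_part_mult: "hom_part n (p * q) = (\<Sum>a\<le>n. hom_part a p * hom_part (n - a) q)"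
  for p q :: dyadic_poly
proof (induction p rule: poly_single_induct)
  case (single m c)
  show ?case
  proof (induction q rule: poly_single_induct)
    case (single m' c')
    have "(\<Sum>a\<le>n. hom_part a (Poly_Mapping.single m c) *
          hom_part (n - a) (Poly_Mapping.single m' c')) =
        (\<Sum>a\<le>n. if a = mon_degree m then Poly_Mapping.single m c *
          hom_part (n - mon_degree m) (Poly_Mapping.single m' c') else 0)"
      by (intro sum.cong) (auto simp: hom_part_single)
    also have "\<dots> = hom_part n (Poly_Mapping.single m c * Poly_Mapping.single m' c')"
      by (auto simp: sum.delta hom_part_single mult_single mon_degree_add)
    finally show ?case ..
  next
    case (add p q)
    thus ?case by (simp add: distrib_left hom_part_add sum.distrib)
  qed
next
  case (add p q)
  thus ?case by (simp add: distrib_right hom_part_add sum.distrib)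
qed

lemma hom_part_Jq_single_low:
  assumes "d < mon_degree m"
  shows "hom_part d (Jq (Poly_Mapping.single m c)) = 0"
proof -
  obtain r where r: "mon_Jq m = Poly_Mapping.single m 1 + r"
      "\<forall>m' \<in> Poly_Mapping.keys r. mon_degree m < mon_degree m'"
    using has_low_term_mon_Jq unfolding has_low_term_def by blast
  have "hom_part d r = 0"
    using r(2) assms by (intro hom_part_eq_0) auto
  thus ?thesis
    using assms by (simp add: Jq_single hom_part_scale r(1) hom_part_add hom_part_single)
qed

lemma Jq_pow_single:
  "Jq_pow n (Poly_Mapping.single m c) = hom_part (mon_degree m + n) (Jq (Poly_Mapping.single m c))"
  by (subst Jq_pow_superset[of "{mon_degree m}"]) (auto simp: hom_part_single)

text \<open>The Cartan formula, obtained by comparing homogeneous components in the multiplicativity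
  of \<open>Jq\<close>.\<close>

lemma Jq_pow_mult: "Jq_pow n (p * q) = (\<Sum>a\<le>n. Jq_pow a p * Jq_pow (n - a) q)"
proof (induction p rule: poly_single_induct)
  case (single m c)
  show ?case
  proof (induction q rule: poly_single_induct)
    case (single m' c')
    let ?s = "Poly_Mapping.single m c" and ?s' = "Poly_Mapping.single m' c'"
    let ?d = "mon_degree m" and ?d' = "mon_degree m'"
    let ?f = "\<lambda>b. hom_part b (Jq ?s) * hom_part (?d + ?d' + n - b) (Jq ?s')"
    have "Jq_pow n (?s * ?s') = (\<Sum>b\<le>?d + ?d' + n. ?f b)"
      by (simp only: mult_single Jq_pow_single mon_degree_add)
        (simp only: Jq_mult hom_part_mult flip: mult_single)
    \<comment> \<open>Put \<open>b = mon_degree m + a\<close>; for every other \<open>b\<close> one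
      factor lies below the lowest degree of its image under \<open>Jq\<close> and vanishes.\<close>
    also have "\<dots> = sum ?f ((+) ?d ` {..n})"
    proof (rule sum.mono_neutral_right)
      show "\<forall>b\<in>{..?d + ?d' + n} - (+) ?d ` {..n}. ?f b = 0"
      proof
        fix b assume b: "b \<in> {..?d + ?d' + n} - (+) ?d ` {..n}"
        have "b < ?d \<or> ?d + ?d' + n - b < ?d'"
        proof (rule ccontr)
          assume "\<not> ?thesis"
          hence "b = ?d + (b - ?d)" "b - ?d \<le> n" using b by auto
          thus False using b by blast
        qed
        thus "?f b = 0" using hom_part_Jq_single_low by auto
      qed
    qed auto
    also have "\<dots> = (\<Sum>a\<le>n. Jq_pow a ?s * Jq_pow (n - a) ?s')"
      by (subst sum.reindex) (auto simp: Jq_pow_single intro!: sum.cong)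
    finally show ?case .
  next
    case (add p q)
    thus ?case by (simp add: distrib_left Jq_pow_add sum.distrib)
  qed
next
  case (add p q)
  thus ?case by (simp add: distrib_right Jq_pow_add sum.distrib)
qed

lemma mon_degree_single: "mon_degree (Poly_Mapping.single i n) = n"
  by (cases "n = 0") (simp_all add: mon_degree_def)

lemma Jq_pow_const: "Jq_pow n (const_poly c) = (if n = 0 then const_poly c else 0)"
  by (simp add: const_poly_def Jq_pow_single mon_degree_def Jq_single mon_Jq_def
      hom_part_single mult_single)

lemma Jq_pow_xi: "Jq_pow n (xi i) = (if n = 0 then xi i else if n = 1 then xi i ^ 2 else 0)"
proof -
  have xi: "xi i = Poly_Mapping.single (Poly_Mapping.single i 1) 1"
    by (simp add: xi_def)
  have "Jq_pow n (xi i) = hom_part (1 + n) (xi i + xi i ^ 2)"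
    by (subst xi, subst Jq_pow_single, fold xi) (simp add: mon_degree_single Jq_xi)
  moreover have "hom_part d (xi i) = (if d = 1 then xi i else 0)" for d
    by (simp add: xi_def hom_part_single mon_degree_single)
  moreover have "hom_part d (xi i ^ 2) = (if d = 2 then xi i ^ 2 else 0)" for d
    by (simp add: xi_power hom_part_single mon_degree_single)
  ultimately show ?thesis
    by (simp add: hom_part_add)
qed

section \<open>A differential equation for the total operation\<close>

text \<open>For \<open>x = \<xi> + t \<xi>\<^sup>2\<close> one has \<open>t dx/dt = t \<xi>\<^sup>2 = t \<xi>\<^sup>2 / (1 + 2 t \<xi>) dx/d\<xi>\<close>; expanding the quotient
  as a geometric series gives the coefficients \<open>(- 2) ^ k\<close> in \<open>Jq_pow_recursion\<close>.\<close>

definition Jq_fps :: "dyadic_poly \<Rightarrow> dyadic_poly fps" where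
  "Jq_fps p = Abs_fps (\<lambda>n. Jq_pow n p)"

definition witt_op_fps :: "nat \<Rightarrow> dyadic_poly fps \<Rightarrow> dyadic_poly fps" where
  "witt_op_fps k f = Abs_fps (\<lambda>n. witt_op k (fps_nth f n))"

lemma Jq_fps_add: "Jq_fps (p + q) = Jq_fps p + Jq_fps q"
  by (rule fps_ext) (simp add: Jq_fps_def Jq_pow_add)

lemma Jq_fps_mult: "Jq_fps (p * q) = Jq_fps p * Jq_fps q"
  by (rule fps_ext) (simp add: Jq_fps_def Jq_pow_mult fps_mult_nth atLeast0AtMost)

lemma witt_op_sum: "witt_op k (sum f A) = (\<Sum>x\<in>A. witt_op k (f x))"
  by (induction A rule: infinite_finite_induct) (simp_all add: witt_op_add witt_op_zero)

lemma witt_op_fps_add: "witt_op_fps k (f + g) = witt_op_fps k f + witt_op_fps k g"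
  by (rule fps_ext) (simp add: witt_op_fps_def witt_op_add)

lemma witt_op_fps_mult: "witt_op_fps k (f * g) = witt_op_fps k f * g + f * witt_op_fps k g"
  by (rule fps_ext) (simp add: witt_op_fps_def witt_op_mult witt_op_sum fps_mult_nth sum.distrib)

lemma witt_op_fps_const: "witt_op_fps k (fps_const p) = fps_const (witt_op k p)"
  by (rule fps_ext) (simp add: witt_op_fps_def witt_op_zero)

lemma witt_op_fps_X: "witt_op_fps k fps_X = 0"
  by (rule fps_ext) (simp add: witt_op_fps_def witt_op_zero witt_op_one fps_X_def)

lemma Jq_fps_const: "Jq_fps (const_poly c) = fps_const (const_poly c)"
  by (rule fps_ext) (simp add: Jq_fps_def Jq_pow_const)

lemma Jq_fps_xi: "Jq_fps (xi i) = fps_const (xi i) + fps_const (xi i ^ 2) * fps_X"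
  by (rule fps_ext) (simp add: Jq_fps_def Jq_pow_xi)

text \<open>The error in the equation
  \<open>t d/dt = (\<Sum>k. (- 2) ^ k t ^ (k + 1) L\<^sub>k)\<close> on \<open>Jq_fps p\<close> when
  the operator sum is cut off after \<open>N\<close> terms.\<close>

definition Jq_defect :: "nat \<Rightarrow> dyadic_poly \<Rightarrow> dyadic_poly fps" where
  "Jq_defect N p = fps_X * fps_deriv (Jq_fps p) -
     (\<Sum>k<N. fps_const ((- 2) ^ k) * fps_X ^ Suc k * witt_op_fps k (Jq_fps p))"

lemma Jq_defect_add: "Jq_defect N (p + q) = Jq_defect N p + Jq_defect N q"
  by (simp add: Jq_defect_def Jq_fps_add witt_op_fps_add distrib_left sum.distrib)

text \<open>Both sides of the equation act as derivations and \<open>Jq_fps\<close> is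
  multiplicative, so the defect is a derivation along \<open>Jq_fps\<close>.\<close>

lemma Jq_defect_mult:
  "Jq_defect N (p * q) = Jq_fps q * Jq_defect N p + Jq_fps p * Jq_defect N q"
  by (simp add: Jq_defect_def Jq_fps_mult witt_op_fps_mult algebra_simps sum.distrib sum_distrib_left)

text \<open>The remainder of a geometric series: each further term cancels the current remainder and
  leaves it multiplied by \<open>- 2 \<xi> t\<close>.\<close>

lemma Jq_defect_xi:
  "Jq_defect N (xi i) = fps_const ((- 2) ^ N * xi i ^ (N + 2)) * fps_X ^ Suc N"
proof (induction N)
  case 0
  show ?case by (simp add: Jq_defect_def Jq_fps_xi power2_eq_square)
next
  case (Suc N)
  have "witt_op N (xi i ^ 2) = 2 * xi i ^ (N + 3)"
    by (simp only: witt_op_power witt_op_xi) (simp add: eval_nat_numeral)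
  hence "witt_op_fps N (Jq_fps (xi i)) =
      fps_const (xi i ^ (N + 2)) + fps_const (2 * xi i ^ (N + 3)) * fps_X"
    by (simp add: Jq_fps_xi witt_op_fps_add witt_op_fps_mult witt_op_fps_const witt_op_fps_X witt_op_xi)
  hence "Jq_defect (Suc N) (xi i) = Jq_defect N (xi i) -
      fps_const ((- 2) ^ N) * fps_X ^ Suc N *
        (fps_const (xi i ^ (N + 2)) + fps_const (2 * xi i ^ (N + 3)) * fps_X)"
    by (simp add: Jq_defect_def algebra_simps)
  also have "\<dots> = - (fps_const ((- 2) ^ N) * fps_X ^ Suc N * (fps_const (2 * xi i ^ (N + 3)) * fps_X))"
    by (simp only: Suc distrib_left) (simp add: mult_ac flip: fps_const_mult)
  also have "\<dots> = fps_const ((- 2) ^ Suc N * xi i ^ (Suc N + 2)) * fps_X ^ Suc (Suc N)"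
    by (simp add: eval_nat_numeral mult_ac flip: fps_const_mult fps_const_neg)
  finally show ?case .
qed

lemma fps_X_power_dvd_Jq_defect: "fps_X ^ Suc N dvd Jq_defect N p"
proof (induction p rule: dyadic_poly_induct)
  case (const c)
  show ?case by (simp add: Jq_defect_def Jq_fps_const witt_op_fps_const witt_op_const)
qed (auto simp: Jq_defect_xi Jq_defect_add Jq_defect_mult simp del: power_Suc intro: dvd_add dvd_mult)

text \<open>The coefficient of \<open>t ^ n\<close> in the differential equation. Cut off at
  \<open>N = n\<close>, the defect is divisible by \<open>t ^ (n + 1)\<close> and does not
  contribute.\<close>

lemma Jq_pow_recursion:
  "of_nat n * Jq_pow n p = (\<Sum>k<n. (- 2) ^ k * witt_op k (Jq_pow (n - Suc k) p))"
proof -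
  obtain g where g: "Jq_defect n p = fps_X ^ Suc n * g"
    using fps_X_power_dvd_Jq_defect by blast
  have "fps_nth (Jq_defect n p) n = 0"
    unfolding g by (simp only: fps_X_power_mult_nth) simp
  moreover have "fps_nth (Jq_defect n p) n = of_nat n * Jq_pow n p -
      (\<Sum>k<n. (- 2) ^ k * witt_op k (Jq_pow (n - Suc k) p))"
    by (cases n) (auto simp: Jq_defect_def fps_sum_nth mult.assoc fps_X_power_mult_nth witt_op_fps_def
      Jq_fps_def simp del: power_Suc intro!: sum.cong)
  ultimately show ?thesis by simp
qed

section \<open>Elements of the algebra as operators\<close>

lemma num_of_int_eq_iff [simp]: "num_of_int c = num_of_int d \<longleftrightarrow> c = d"
  by (simp add: num_of_int_def eq_fract)

lemma num_of_int_eq_0_iff [simp]: "num_of_int c = 0 \<longleftrightarrow> c = 0"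
  using num_of_int_eq_iff[of c 0] by (simp add: num_of_int_simps)

lemma num_of_int_of_nat: "num_of_int (of_nat n) = of_nat n"
  by (induction n) (simp_all add: num_of_int_simps)

instance fract :: ("{idom, ring_char_0}") ring_char_0
proof
  show "inj (of_nat :: nat \<Rightarrow> 'a fract)"
    by (rule injI) (simp add: of_nat_fract eq_fract)
qed

instance fract :: ("{idom, ring_char_0}") field_char_0 ..

lemma num_of_int_minus: "num_of_int (- c) = - num_of_int c"
  using num_of_int_simps(3)[of "- c" c] by (simp add: num_of_int_simps eq_neg_iff_add_eq_0)

lemma num_of_int_of_int: "num_of_int (of_int n) = of_int n"
  by (cases n) (simp_all add: num_of_int_of_nat num_of_int_minus del: of_nat_Suc)

section \<open>Scalars and coefficient functionals\<close>

lemma tensor_zero [simp]: "tensor 0 q = 0" "tensor a 0 = 0"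
  using tensor_simps(1)[of 0 0 q] tensor_simps(2)[of a 0 0] by simp_all

lemma tensor_induct [case_names tensor add]:
  assumes "\<And>a q. P (tensor a q)" "\<And>x y. P x \<Longrightarrow> P y \<Longrightarrow> P (x + y)"
  shows "P x"
proof -
  obtain A where x: "x = tensor_class A" by (rule tensor_class_cases)
  have "P (tensor_class A)"
  proof (induction A)
    case empty
    show ?case using assms(1)[of 0 0] by (simp add: zero_dyadic_steenrod_Q_def)
  next
    case (add x A)
    have "tensor_class (add_mset x A) = tensor (fst x) (snd x) + tensor_class A"
      by (simp add: tensor_def tensor_class_arith)
    thus ?case using assms add by simp
  qed
  thus ?thesis by (simp add: x)
qed

text \<open>Scalars act through the central elements \<open>tensor 1 q\<close>; the resulting vector
  space gives access to spans, bases and coordinates.\<close>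

definition scalar :: "dyadic_num \<Rightarrow> dyadic_steenrod_Q \<Rightarrow> dyadic_steenrod_Q" where
  "scalar q x = tensor 1 q * x"

lemma scalar_tensor: "scalar q (tensor a r) = tensor a (q * r)"
  by (simp add: scalar_def tensor_simps)

interpretation Q: vector_space scalar
  by unfold_locales
    (simp_all add: scalar_def tensor_simps(2,4) distrib_left distrib_right
      flip: mult.assoc tensor_simps(5))

lemma scalar_mult_left: "scalar q x * y = scalar q (x * y)"
  by (simp add: scalar_def mult.assoc)

lemma scalar_mult_right: "x * scalar q y = scalar q (x * y)"
proof -
  have "x * tensor 1 q = tensor 1 q * x"
    by (induction x rule: tensor_induct) (simp_all add: tensor_simps distrib_left distrib_right mult.commute)
  thus ?thesis by (simp add: scalar_def flip: mult.assoc)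
qed

text \<open>A matrix coefficient of the operator, extended to the tensor product; these functionals
  detect linear independence. The choice of representative is removed by
  \<open>coef_tensor_class\<close>.\<close>

definition coef :: "dyadic_poly \<Rightarrow> monomial \<Rightarrow> dyadic_steenrod_Q \<Rightarrow> dyadic_num" where
  "coef p m x = (\<Sum>(a, q)\<in>#rep_tensor x. num_of_int (Poly_Mapping.lookup (steenrod_apply a p) m) * q)"

lemma coef_tensor_class:
  "coef p m (tensor_class A) =
     (\<Sum>(a, q)\<in>#A. num_of_int (Poly_Mapping.lookup (steenrod_apply a p) m) * q)"
proof -
  have "tensor_rel A B \<Longrightarrow>
      (\<Sum>(a, q)\<in>#A. num_of_int (Poly_Mapping.lookup (steenrod_apply a p) m) * q) =
      (\<Sum>(a, q)\<in>#B. num_of_int (Poly_Mapping.lookup (steenrod_apply a p) m) * q)" for A B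
    by (induction rule: tensor_rel.induct)
      (auto simp: plus_dyadic_steenrod.rep_eq zero_dyadic_steenrod.rep_eq
        steenrod_scale.rep_eq lookup_add lookup_const_poly_mult num_of_int_simps algebra_simps)
  from this[OF tensor_rel_rep] show ?thesis by (simp add: coef_def)
qed

lemma coef_tensor:
  "coef p m (tensor a q) = num_of_int (Poly_Mapping.lookup (steenrod_apply a p) m) * q"
  by (simp add: tensor_def coef_tensor_class)

lemma coef_add: "coef p m (x + y) = coef p m x + coef p m y"
  by (cases x rule: tensor_class_cases; cases y rule: tensor_class_cases)
    (simp add: tensor_class_arith coef_tensor_class)

lemma coef_scalar: "coef p m (scalar q x) = q * coef p m x"
  by (induction x rule: tensor_induct)
    (simp_all add: scalar_tensor coef_tensor coef_add Q.scale_right_distrib distrib_left mult_ac)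

lemma coef_sum: "coef p m (sum f A) = (\<Sum>x\<in>A. coef p m (f x))"
  using coef_scalar[of p m 0 0]
  by (induction A rule: infinite_finite_induct) (simp_all add: coef_add)

section \<open>Operators up to denominators\<close>

text \<open>The operator \<open>T\<close> itself need not lie in the algebra over the dyadic integers, only some
  non-zero multiple of it.\<close>

definition represents :: "dyadic_steenrod_Q \<Rightarrow> (dyadic_poly \<Rightarrow> dyadic_poly) \<Rightarrow> bool" where
  "represents x T \<longleftrightarrow> (\<exists>d \<theta>. d \<noteq> 0 \<and> scalar (num_of_int d) x = tensor \<theta> 1 \<and>
     (\<forall>p. steenrod_apply \<theta> p = const_poly d * T p))"

lemma tensor_steenrod_scale: "tensor (steenrod_scale c a) 1 = scalar (num_of_int c) (tensor a 1)"
  by (simp add: tensor_simps scalar_tensor)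

text \<open>Multiplying by both denominators moves the comparison to the integral algebra, whose
  elements are operators. Operator identities thereby become identities in the algebra.\<close>

lemma represents_unique:
  assumes "represents x T" "represents y T"
  shows "x = y"
proof -
  from assms obtain c d \<theta> \<eta> where
    x: "c \<noteq> 0" "scalar (num_of_int c) x = tensor \<theta> 1" "\<And>p. steenrod_apply \<theta> p = const_poly c * T p" and
    y: "d \<noteq> 0" "scalar (num_of_int d) y = tensor \<eta> 1" "\<And>p. steenrod_apply \<eta> p = const_poly d * T p"
    unfolding represents_def by metis
  have "steenrod_scale d \<theta> = steenrod_scale c \<eta>"
    by (simp flip: steenrod_apply_inject add: steenrod_scale.rep_eq x y mult_ac)
  hence "scalar (num_of_int d) (tensor \<theta> 1) = scalar (num_of_int c) (tensor \<eta> 1)"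
    by (simp flip: tensor_steenrod_scale)
  hence "scalar (num_of_int c * num_of_int d) x = scalar (num_of_int c * num_of_int d) y"
    by (simp flip: x y add: mult_ac)
  thus ?thesis using x y by simp
qed

lemma steenrod_apply_linear:
  "steenrod_apply a (p + q) = steenrod_apply a p + steenrod_apply a q"
  "steenrod_apply a (const_poly c * p) = const_poly c * steenrod_apply a p"
  using steenrod_ops_linear[OF steenrod_apply] by auto

lemma represents_add:
  assumes "represents x T" "represents y U"
  shows "represents (x + y) (\<lambda>p. T p + U p)"
proof -
  from assms obtain c d \<theta> \<eta> where
    x: "c \<noteq> 0" "scalar (num_of_int c) x = tensor \<theta> 1" "\<And>p. steenrod_apply \<theta> p = const_poly c * T p" and
    y: "d \<noteq> 0" "scalar (num_of_int d) y = tensor \<eta> 1" "\<And>p. steenrod_apply \<eta> p = const_poly d * U p"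
    unfolding represents_def by metis
  have "scalar (num_of_int (c * d)) (x + y) =
      scalar (num_of_int d) (scalar (num_of_int c) x) + scalar (num_of_int c) (scalar (num_of_int d) y)"
    by (simp add: num_of_int_simps Q.scale_right_distrib mult.commute)
  also have "\<dots> = tensor (steenrod_scale d \<theta> + steenrod_scale c \<eta>) 1"
    by (simp add: x y tensor_simps(1) tensor_steenrod_scale)
  finally show ?thesis
    unfolding represents_def using x(1) y(1)
    by (intro exI[of _ "c * d"] exI[of _ "steenrod_scale d \<theta> + steenrod_scale c \<eta>"])
      (simp add: plus_dyadic_steenrod.rep_eq steenrod_scale.rep_eq x y const_poly_simps algebra_simps)
qed

lemma represents_mult:
  assumes "represents x T" "represents y U"
  shows "represents (x * y) (\<lambda>p. T (U p))"
proof -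
  from assms obtain c d \<theta> \<eta> where
    x: "c \<noteq> 0" "scalar (num_of_int c) x = tensor \<theta> 1" "\<And>p. steenrod_apply \<theta> p = const_poly c * T p" and
    y: "d \<noteq> 0" "scalar (num_of_int d) y = tensor \<eta> 1" "\<And>p. steenrod_apply \<eta> p = const_poly d * U p"
    unfolding represents_def by metis
  have "scalar (num_of_int (c * d)) (x * y) = scalar (num_of_int c) x * scalar (num_of_int d) y"
    by (simp add: num_of_int_simps scalar_mult_left scalar_mult_right mult.commute)
  also have "\<dots> = tensor (\<theta> * \<eta>) 1"
    by (simp add: x y tensor_simps)
  finally show ?thesis
    unfolding represents_def using x(1) y(1)
    by (intro exI[of _ "c * d"] exI[of _ "\<theta> * \<eta>"])
      (simp add: times_dyadic_steenrod.rep_eq x y steenrod_apply_linear const_poly_simps mult_ac)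
qed

lemma represents_scalar:
  assumes "represents x T"
  shows "represents (scalar (num_of_int c) x) (\<lambda>p. const_poly c * T p)"
proof -
  from assms obtain d \<theta> where
    x: "d \<noteq> 0" "scalar (num_of_int d) x = tensor \<theta> 1" "\<And>p. steenrod_apply \<theta> p = const_poly d * T p"
    unfolding represents_def by metis
  have "scalar (num_of_int d) (scalar (num_of_int c) x) = tensor (steenrod_scale c \<theta>) 1"
    by (simp add: tensor_steenrod_scale mult.commute flip: x)
  thus ?thesis
    unfolding represents_def using x(1)
    by (intro exI[of _ d] exI[of _ "steenrod_scale c \<theta>"]) (simp add: steenrod_scale.rep_eq x mult_ac)
qed

text \<open>The denominator allowed by \<open>represents\<close> absorbs \<open>c\<close>. This
  justifies the divisions by 2 and by \<open>Suc k\<close> in \<open>witt\<close>.\<close>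

lemma represents_divide:
  assumes "represents x (\<lambda>p. const_poly c * T p)" "c \<noteq> 0"
  shows "represents (scalar (inverse (num_of_int c)) x) T"
proof -
  from assms obtain d \<theta> where
    x: "d \<noteq> 0" "scalar (num_of_int d) x = tensor \<theta> 1"
       "\<And>p. steenrod_apply \<theta> p = const_poly d * (const_poly c * T p)"
    unfolding represents_def by metis
  have "scalar (num_of_int (d * c)) (scalar (inverse (num_of_int c)) x) = tensor \<theta> 1"
  proof -
    have "num_of_int (d * c) * inverse (num_of_int c) = num_of_int d"
      using assms(2) by (simp add: num_of_int_simps field_simps)
    thus ?thesis by (simp only: Q.scale_scale x(2))
  qed
  thus ?thesis
    unfolding represents_def using x(1) assms(2)
    by (intro exI[of _ "d * c"] exI[of _ \<theta>]) (simp add: x const_poly_simps mult_ac)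
qed

lemma represents_minus:
  assumes "represents x T"
  shows "represents (- x) (\<lambda>p. - T p)"
  using represents_scalar[OF assms, of "- 1"]
  by (simp add: num_of_int_minus num_of_int_simps const_poly_minus_one)

lemma represents_diff:
  assumes "represents x T" "represents y U"
  shows "represents (x - y) (\<lambda>p. T p - U p)"
  using represents_add[OF assms(1) represents_minus[OF assms(2)]] by simp

lemma represents_tensor: "represents (tensor \<theta> 1) (steenrod_apply \<theta>)"
  unfolding represents_def
  by (intro exI[of _ 1] exI[of _ \<theta>]) (simp add: num_of_int_simps const_poly_simps)

lemma represents_zero: "represents 0 (\<lambda>p. 0)"
  using represents_tensor[of 0] by (simp add: zero_dyadic_steenrod.rep_eq)

lemma represents_one: "represents 1 (\<lambda>p. p)"
  using represents_tensor[of 1] by (simp add: one_dyadic_steenrod.rep_eq id_def flip: tensor_simps(5))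

lemma represents_sum:
  assumes "\<And>i. i \<in> A \<Longrightarrow> represents (x i) (T i)"
  shows "represents (\<Sum>i\<in>A. x i) (\<lambda>p. \<Sum>i\<in>A. T i p)"
  using assms by (induction A rule: infinite_finite_induct) (simp_all add: represents_zero represents_add)

lemma coef_represents:
  assumes "represents x T"
  shows "coef p m x = num_of_int (Poly_Mapping.lookup (T p) m)"
proof -
  from assms obtain d \<theta> where
    x: "d \<noteq> 0" "scalar (num_of_int d) x = tensor \<theta> 1" "\<And>p. steenrod_apply \<theta> p = const_poly d * T p"
    unfolding represents_def by metis
  have "num_of_int d * coef p m x = num_of_int d * num_of_int (Poly_Mapping.lookup (T p) m)"
    by (simp flip: coef_scalar add: x coef_tensor lookup_const_poly_mult num_of_int_simps)
  thus ?thesis using x(1) by simp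
qed

section \<open>The Lie algebra generators\<close>

text \<open>Solves \<open>Jq^2 = L_0^2 / 2 - L_1\<close> for \<open>L_1\<close> and
  \<open>[L_0, L_(k+1)] = (k + 1) L_(k+2)\<close> for \<open>L_(k+2)\<close>. Starting from the
  generators of the ideal makes visible which of its powers contains \<open>witt k\<close>.\<close>

fun witt :: "nat \<Rightarrow> dyadic_steenrod_Q" where
  "witt 0 = tensor (Jq_op 1) 1"
| "witt (Suc 0) = scalar (inverse 2) (witt 0 * witt 0) - tensor (Jq_op 2) 1"
| "witt (Suc (Suc k)) =
     scalar (inverse (of_nat (Suc k))) (witt 0 * witt (Suc k) - witt (Suc k) * witt 0)"

lemma Jq_pow_1: "Jq_pow 1 p = witt_op 0 p"
  using Jq_pow_recursion[of 1 p] by (simp add: Jq_pow_0)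

lemma Jq_pow_2: "2 * Jq_pow 2 p = witt_op 0 (witt_op 0 p) - 2 * witt_op 1 p"
  using Jq_pow_recursion[of 2 p]
  by (simp add: Jq_pow_0 Jq_pow_1[simplified] eval_nat_numeral lessThan_Suc)

lemma represents_witt: "represents (witt k) (witt_op k)"
proof (induction k rule: witt.induct)
  case 1
  have "Jq_pow 1 = witt_op 0" by (rule ext) (rule Jq_pow_1)
  thus ?case using represents_tensor[of "Jq_op 1"] by (simp add: Jq_op.rep_eq)
next
  case 2
  have two: "num_of_int 2 = 2" "const_poly 2 = 2"
    using num_of_int_of_int[of 2] const_poly_of_int[of 2] by simp_all
  have "represents (witt 0 * witt 0 - scalar (num_of_int 2) (tensor (Jq_op 2) 1))
      (\<lambda>p. witt_op 0 (witt_op 0 p) - const_poly 2 * Jq_pow 2 p)"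
    by (intro represents_diff represents_mult represents_scalar 2)
      (use represents_tensor[of "Jq_op 2"] in \<open>simp add: Jq_op.rep_eq\<close>)
  hence "represents (witt 0 * witt 0 - scalar 2 (tensor (Jq_op 2) 1)) (\<lambda>p. const_poly 2 * witt_op 1 p)"
    by (simp add: two Jq_pow_2)
  from represents_divide[OF this] show ?case
    by (simp add: two Q.scale_right_diff_distrib)
next
  case (3 k)
  have "represents (witt 0 * witt (Suc k) - witt (Suc k) * witt 0)
      (\<lambda>p. witt_op 0 (witt_op (Suc k) p) - witt_op (Suc k) (witt_op 0 p))"
    by (intro represents_diff represents_mult 3)
  hence "represents (witt 0 * witt (Suc k) - witt (Suc k) * witt 0)
      (\<lambda>p. const_poly (of_nat (Suc k)) * witt_op (Suc (Suc k)) p)"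
    using const_poly_of_int[of "int (Suc k)"] by (simp add: witt_op_commutator del: of_nat_Suc)
  from represents_divide[OF this] show ?case
    by (simp add: num_of_int_of_nat del: of_nat_Suc)
qed

lemma witt_commutator:
  "witt i * witt j - witt j * witt i = scalar (of_int (int j - int i)) (witt (i + j + 1))"
proof (rule represents_unique)
  show "represents (witt i * witt j - witt j * witt i)
      (\<lambda>p. witt_op i (witt_op j p) - witt_op j (witt_op i p))"
    by (intro represents_diff represents_mult represents_witt)
  show "represents (scalar (of_int (int j - int i)) (witt (i + j + 1)))
      (\<lambda>p. witt_op i (witt_op j p) - witt_op j (witt_op i p))"
    using represents_scalar[OF represents_witt, of "of_int (int j - int i)" "i + j + 1"]
    by (simp only: witt_op_commutator num_of_int_of_int const_poly_of_int)
qed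

lemma Jq_op_recursion:
  "scalar (of_nat n) (tensor (Jq_op n) 1) =
     (\<Sum>k<n. scalar ((- 2) ^ k) (witt k * tensor (Jq_op (n - Suc k)) 1))"
proof (rule represents_unique)
  have Jq: "represents (tensor (Jq_op n) 1) (Jq_pow n)" for n
    using represents_tensor[of "Jq_op n"] by (simp add: Jq_op.rep_eq)
  show "represents (scalar (of_nat n) (tensor (Jq_op n) 1)) (\<lambda>p. of_nat n * Jq_pow n p)"
    using represents_scalar[OF Jq, of "of_nat n" n] const_poly_of_int[of "int n"]
    by (simp add: num_of_int_of_nat)
  have scal: "num_of_int ((- 2) ^ k) = (- 2) ^ k" "const_poly ((- 2) ^ k) = (- 2) ^ k" for k
    using num_of_int_of_int[of "(- 2) ^ k"] const_poly_of_int[of "(- 2) ^ k"] by simp_all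
  have "represents (scalar ((- 2) ^ k) (witt k * tensor (Jq_op (n - Suc k)) 1))
      (\<lambda>p. (- 2) ^ k * witt_op k (Jq_pow (n - Suc k) p))" for k
    using represents_scalar[OF represents_mult[OF represents_witt Jq], of "(- 2) ^ k"]
    by (simp only: scal)
  from represents_sum[OF this]
  show "represents (\<Sum>k<n. scalar ((- 2) ^ k) (witt k * tensor (Jq_op (n - Suc k)) 1))
      (\<lambda>p. of_nat n * Jq_pow n p)"
    by (simp only: Jq_pow_recursion)
qed

section \<open>Words in the generators span the algebra\<close>

definition word :: "nat list \<Rightarrow> dyadic_steenrod_Q" where
  "word ks = prod_list (map witt ks)"

lemma word_simps [simp]:
  "word [] = 1" "word (k # ks) = witt k * word ks" "word (ks @ ls) = word ks * word ls"
  by (simp_all add: word_def)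

lemma span_mult:
  assumes "x \<in> Q.span S" "y \<in> Q.span T" "\<And>s t. s \<in> S \<Longrightarrow> t \<in> T \<Longrightarrow> s * t \<in> Q.span U"
  shows "x * y \<in> Q.span U"
  using assms(1)
proof (induction rule: Q.span_induct_alt)
  case (step c s z)
  have "s * y \<in> Q.span U"
    using assms(2)
  proof (induction rule: Q.span_induct_alt)
    case (step c' t z')
    thus ?case using assms(3)[OF \<open>s \<in> S\<close>]
      by (simp add: distrib_left scalar_mult_right Q.span_add Q.span_scale)
  qed (simp add: Q.span_zero)
  thus ?case using step
    by (simp add: distrib_right scalar_mult_left Q.span_add Q.span_scale)
qed (simp add: Q.span_zero)

text \<open>The recursion writes every \<open>Jq_op n\<close> through the \<open>witt k\<close> and
  lower operations; sums, scalars and compositions stay in the span.\<close>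

lemma span_word: "Q.span (range word) = UNIV"
proof -
  let ?W = "Q.span (range word)"
  have mult: "x * y \<in> ?W" if "x \<in> ?W" "y \<in> ?W" for x y
    by (rule span_mult[OF that]) (auto simp flip: word_simps intro: Q.span_base)
  have Jq: "tensor (Jq_op n) 1 \<in> ?W" for n
  proof (induction n rule: less_induct)
    case (less n)
    show ?case
    proof (cases n)
      case 0
      have "Jq_op 0 = 1" by (transfer) (simp add: Jq_pow_0)
      hence "tensor (Jq_op n) 1 = word []" by (simp add: 0 tensor_simps)
      thus ?thesis by (simp only: Q.span_base rangeI)
    next
      case (Suc n')
      have "of_nat n \<noteq> (0 :: dyadic_num)"
        using Suc by (simp del: of_nat_Suc)
      \<comment> \<open>Division by \<open>n\<close>, which may be even, uses the extended
        scalars.\<close>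
      hence "tensor (Jq_op n) 1 = scalar (inverse (of_nat n)) (scalar (of_nat n) (tensor (Jq_op n) 1))"
        by simp
      also have "\<dots> \<in> ?W"
        unfolding Jq_op_recursion
      proof (intro Q.span_scale Q.span_sum mult)
        fix k assume "k \<in> {..<n}"
        thus "tensor (Jq_op (n - Suc k)) 1 \<in> ?W" using less by simp
        have "witt k = word [k]" by simp
        thus "witt k \<in> ?W" by (simp only: Q.span_base rangeI)
      qed
      finally show ?thesis .
    qed
  qed
  have "tensor (Abs_dyadic_steenrod f) 1 \<in> ?W" if "f \<in> steenrod_ops" for f
    using that
  proof (induction rule: steenrod_ops.induct)
    case (Jq_pow k)
    show ?case using Jq[of k] by (simp add: Jq_op_def)
  next
    case (add f g)
    hence "Abs_dyadic_steenrod (\<lambda>p. f p + g p) = Abs_dyadic_steenrod f + Abs_dyadic_steenrod g"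
      by (simp add: plus_dyadic_steenrod.abs_eq eq_onp_same_args)
    thus ?case using add by (simp add: tensor_simps Q.span_add)
  next
    case (scale f c)
    hence "Abs_dyadic_steenrod (\<lambda>p. const_poly c * f p) = steenrod_scale c (Abs_dyadic_steenrod f)"
      by (simp add: steenrod_scale.abs_eq eq_onp_same_args)
    thus ?case using scale by (simp add: tensor_steenrod_scale Q.span_scale)
  next
    case (comp f g)
    hence "tensor (Abs_dyadic_steenrod (f \<circ> g)) 1 =
        tensor (Abs_dyadic_steenrod f) 1 * tensor (Abs_dyadic_steenrod g) 1"
      by (simp add: times_dyadic_steenrod.abs_eq eq_onp_same_args tensor_simps)
    thus ?case using comp(3,4) by (simp only: mult)
  qed
  hence op: "tensor \<theta> 1 \<in> ?W" for \<theta>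
    by (metis steenrod_apply steenrod_apply_inverse)
  have "x \<in> ?W" for x
  proof (induction x rule: tensor_induct)
    case (tensor a q)
    have "tensor a q = scalar q (tensor a 1)" by (simp add: scalar_tensor)
    thus ?case by (simp only: Q.span_scale op)
  qed (rule Q.span_add)
  thus ?thesis by blast
qed

section \<open>Linear independence of the ordered words\<close>

text \<open>Natural numbers cannot cancel in characteristic zero; this gives exact supports below
  instead of mere inclusions.\<close>

lemma sum_Nats_eq_0_iff:
  fixes f :: "'a \<Rightarrow> 'b :: {semiring_char_0}"
  assumes "finite A" "\<And>x. x \<in> A \<Longrightarrow> f x \<in> \<nat>"
  shows "sum f A = 0 \<longleftrightarrow> (\<forall>x\<in>A. f x = 0)"
proof -
  have "\<forall>x\<in>A. \<exists>n. f x = of_nat n"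
    using assms(2) by (meson Nats_cases)
  then obtain g where g: "\<And>x. x \<in> A \<Longrightarrow> f x = of_nat (g x)"
    by metis
  have "sum f A = of_nat (sum g A)" by (simp add: g)
  hence "sum f A = 0 \<longleftrightarrow> sum g A = 0" by (simp only: of_nat_eq_0_iff)
  thus ?thesis using assms(1) by (simp add: g)
qed

lemma lookup_witt_op:
  "Poly_Mapping.lookup (witt_op k p) m' = (\<Sum>m\<in>Poly_Mapping.keys p. \<Sum>i\<in>Poly_Mapping.keys m.
     if m' = m + Poly_Mapping.single i (Suc k)
     then Poly_Mapping.lookup p m * of_nat (Poly_Mapping.lookup m i) else 0)"
  by (simp add: witt_op_def mon_witt_op_def lookup_sum lookup_const_poly_mult lookup_single when_def
      sum_distrib_left if_distrib eq_commute cong: if_cong)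

lemma Nats_sum: "(\<And>x. x \<in> A \<Longrightarrow> f x \<in> \<nat>) \<Longrightarrow> sum f A \<in> \<nat>"
  by (induction A rule: infinite_finite_induct) auto

definition nat_coeffs :: "dyadic_poly \<Rightarrow> bool" where
  "nat_coeffs p \<longleftrightarrow> (\<forall>m. Poly_Mapping.lookup p m \<in> \<nat>)"

lemma nat_coeffs_witt_op: "nat_coeffs p \<Longrightarrow> nat_coeffs (witt_op k p)"
  unfolding nat_coeffs_def lookup_witt_op by (intro allI Nats_sum) auto

text \<open>With natural coefficients nothing cancels, so every choice of a monomial and of a
  variable in it survives.\<close>

lemma keys_witt_op:
  assumes "nat_coeffs p"
  shows "Poly_Mapping.keys (witt_op k p) =
     {m + Poly_Mapping.single i (Suc k) | m i. m \<in> Poly_Mapping.keys p \<and> i \<in> Poly_Mapping.keys m}"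
proof -
  have "Poly_Mapping.lookup (witt_op k p) m' = 0 \<longleftrightarrow> (\<forall>m\<in>Poly_Mapping.keys p. \<forall>i\<in>Poly_Mapping.keys m.
     m' \<noteq> m + Poly_Mapping.single i (Suc k))" for m'
  proof -
    let ?f = "\<lambda>m i. if m' = m + Poly_Mapping.single i (Suc k)
      then Poly_Mapping.lookup p m * of_nat (Poly_Mapping.lookup m i) else 0"
    have nat: "?f m i \<in> \<nat>" for m i
      using assms by (simp add: nat_coeffs_def)
    have "Poly_Mapping.lookup (witt_op k p) m' = 0 \<longleftrightarrow>
        (\<forall>m\<in>Poly_Mapping.keys p. (\<Sum>i\<in>Poly_Mapping.keys m. ?f m i) = 0)"
      unfolding lookup_witt_op by (intro sum_Nats_eq_0_iff Nats_sum nat) auto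
    also have "\<dots> \<longleftrightarrow> (\<forall>m\<in>Poly_Mapping.keys p. \<forall>i\<in>Poly_Mapping.keys m. ?f m i = 0)"
      by (intro ball_cong refl sum_Nats_eq_0_iff nat) auto
    finally show ?thesis by (auto simp: in_keys_iff)
  qed
  hence "m' \<in> Poly_Mapping.keys (witt_op k p) \<longleftrightarrow> (\<exists>m\<in>Poly_Mapping.keys p. \<exists>i\<in>Poly_Mapping.keys m.
     m' = m + Poly_Mapping.single i (Suc k))" for m'
    by (simp add: in_keys_iff[of _ "witt_op k p"])
  thus ?thesis by blast
qed

definition witt_op_word :: "nat list \<Rightarrow> dyadic_poly \<Rightarrow> dyadic_poly" where
  "witt_op_word ks p = foldr witt_op ks p"

lemma represents_word: "represents (word ks) (witt_op_word ks)"
  unfolding witt_op_word_def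
  by (induction ks) (use represents_mult[OF represents_witt] in \<open>simp_all add: represents_one\<close>)

section \<open>Detecting words on multilinear monomials\<close>

text \<open>A word of length \<open>n\<close> is detected on \<open>\<xi>\<^sub>0 \<cdots> \<xi>\<^bsub>n-1\<^esub>\<close> by the terms in which all exponents have
  grown: each factor must hit a different variable, and a shorter word cannot produce such terms.\<close>

definition multilinear :: "nat \<Rightarrow> monomial" where
  "multilinear n = (\<Sum>i<n. Poly_Mapping.single i 1)"

lemma lookup_multilinear: "Poly_Mapping.lookup (multilinear n) i = (if i < n then 1 else 0)"
  by (simp add: multilinear_def lookup_sum lookup_single when_def)

definition multilinear_image :: "nat list \<Rightarrow> nat \<Rightarrow> dyadic_poly" where
  "multilinear_image ks n = witt_op_word ks (Poly_Mapping.single (multilinear n) 1)"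

lemma keys_multilinear_image:
  "Poly_Mapping.keys (multilinear_image [] n) = {multilinear n}"
  "Poly_Mapping.keys (multilinear_image (k # ks) n) =
     {m + Poly_Mapping.single i (Suc k) | m i.
       m \<in> Poly_Mapping.keys (multilinear_image ks n) \<and> i \<in> Poly_Mapping.keys m}"
proof -
  have "nat_coeffs (multilinear_image ks n)"
    unfolding multilinear_image_def witt_op_word_def
    by (induction ks) (auto simp: nat_coeffs_witt_op, auto simp: nat_coeffs_def lookup_single when_def)
  from keys_witt_op[OF this]
  show "Poly_Mapping.keys (multilinear_image (k # ks) n) =
     {m + Poly_Mapping.single i (Suc k) | m i.
       m \<in> Poly_Mapping.keys (multilinear_image ks n) \<and> i \<in> Poly_Mapping.keys m}"
    by (simp add: multilinear_image_def witt_op_word_def)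
qed (simp add: multilinear_image_def witt_op_word_def)

text \<open>\<open>T\<close> consists of the variables hit by some factor, and each factor adds at
  most one. If each adds one, no variable is hit twice, and the exponent \<open>1 + Suc k\<close>
  reveals the factor \<open>k\<close>.\<close>

lemma keys_multilinear_image_constraint:
  assumes "m \<in> Poly_Mapping.keys (multilinear_image ks n)"
  defines "T \<equiv> {i. i < n \<and> Poly_Mapping.lookup m i \<ge> 2}"
  shows "Poly_Mapping.keys m = {..<n} \<and> card T \<le> length ks \<and>
    (card T = length ks \<longrightarrow>
      image_mset (Poly_Mapping.lookup m) (mset_set T) = image_mset (\<lambda>k. k + 2) (mset ks))"
  using assms(1) unfolding T_def
proof (induction ks arbitrary: m)
  case Nil
  thus ?case by (auto simp: keys_multilinear_image lookup_multilinear in_keys_iff split: if_splits)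
next
  case (Cons k ks)
  then obtain m' i where m': "m = m' + Poly_Mapping.single i (Suc k)"
      "m' \<in> Poly_Mapping.keys (multilinear_image ks n)" "i \<in> Poly_Mapping.keys m'"
    by (auto simp: keys_multilinear_image)
  let ?T = "\<lambda>m. {i. i < n \<and> Poly_Mapping.lookup m i \<ge> 2}"
  note IH = Cons.IH[OF m'(2)]
  have keys': "Poly_Mapping.lookup m' j \<noteq> 0 \<longleftrightarrow> j < n" for j
    using IH by (metis in_keys_iff lessThan_iff)
  have i: "i < n" "Poly_Mapping.lookup m' i \<ge> 1"
    using m'(3) keys'[of i] by (simp_all add: in_keys_iff)
  have lookup: "Poly_Mapping.lookup m j = Poly_Mapping.lookup m' j + (if j = i then Suc k else 0)" for j
    by (auto simp: m'(1) lookup_add lookup_single when_def)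
  have T: "?T m = insert i (?T m')"
    using i by (auto simp: lookup)
  have keys: "Poly_Mapping.keys m = {..<n}"
  proof (rule Set.set_eqI)
    fix j
    show "j \<in> Poly_Mapping.keys m \<longleftrightarrow> j \<in> {..<n}"
      using i(1) keys'[of j] by (cases "j = i") (simp_all add: in_keys_iff lookup)
  qed
  show ?case
  proof (cases "i \<in> ?T m'")
    case True
    \<comment> \<open>\<open>T\<close> stays the same while the word grows, so the case of equality
      cannot occur.\<close>
    thus ?thesis using IH T keys by (simp add: insert_absorb)
  next
    case False
    hence "Poly_Mapping.lookup m' i = 1" using i by simp
    hence m_i: "Poly_Mapping.lookup m i = k + 2" by (simp add: lookup)
    have card: "card (?T m) = Suc (card (?T m'))"
      unfolding T using False by (subst card_insert_disjoint) auto
    have "image_mset (Poly_Mapping.lookup m) (mset_set (?T m)) =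
        add_mset (k + 2) (image_mset (Poly_Mapping.lookup m) (mset_set (?T m')))"
      unfolding T using False by (simp add: m_i)
    also have "image_mset (Poly_Mapping.lookup m) (mset_set (?T m')) =
        image_mset (Poly_Mapping.lookup m') (mset_set (?T m'))"
      using False by (intro image_mset_cong) (auto simp: lookup)
    finally show ?thesis using IH card keys by simp
  qed
qed

text \<open>\<open>zs\<close> pairs each factor with the variable it is to hit; any such choice is
  realised because no variable ever disappears.\<close>

lemma mem_keys_multilinear_image:
  assumes "\<And>k i. (k, i) \<in> set zs \<Longrightarrow> i < n"
  shows "multilinear n + (\<Sum>(k, i)\<leftarrow>zs. Poly_Mapping.single i (Suc k))
    \<in> Poly_Mapping.keys (multilinear_image (map fst zs) n)"
  using assms
proof (induction zs)
  case (Cons z zs)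
  obtain k i where z: "z = (k, i)" by (cases z)
  have "i < n" using Cons.prems z by auto
  hence "i \<in> Poly_Mapping.keys (multilinear n + (\<Sum>(k, i)\<leftarrow>zs. Poly_Mapping.single i (Suc k)))"
    by (simp add: in_keys_iff lookup_add lookup_multilinear)
  moreover have "multilinear n + (\<Sum>(k, i)\<leftarrow>zs. Poly_Mapping.single i (Suc k))
    \<in> Poly_Mapping.keys (multilinear_image (map fst zs) n)"
    using Cons by auto
  ultimately show ?case
    by (auto simp: keys_multilinear_image z add_ac intro!: exI)
qed (simp add: keys_multilinear_image)

lemma multilinear_separates:
  obtains m where
    "m \<in> Poly_Mapping.keys (multilinear_image ks (length ks))"
    "\<And>ls. m \<in> Poly_Mapping.keys (multilinear_image ls (length ks)) \<Longrightarrow> length ls \<le> length ks \<Longrightarrow>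
       mset ls = mset ks"
proof -
  let ?n = "length ks"
  \<comment> \<open>The separating monomial: the letter at position \<open>i\<close> hits variable
    \<open>i\<close>, so all exponents grow.\<close>
  define zs where "zs = zip ks [0..<?n]"
  define m where "m = multilinear ?n + (\<Sum>(k, i)\<leftarrow>zs. Poly_Mapping.single i (Suc k))"
  have "map fst zs = ks" by (simp add: zs_def)
  moreover have "i < ?n" if "(k, i) \<in> set zs" for k i
    using that by (auto simp: zs_def set_zip)
  ultimately have m: "m \<in> Poly_Mapping.keys (multilinear_image ks ?n)"
    using mem_keys_multilinear_image[of zs ?n] by (simp add: m_def)
  have "Poly_Mapping.lookup m i \<ge> 2" if i: "i < ?n" for i
  proof -
    have "(ks ! i, i) \<in> set zs" using i by (auto simp: zs_def set_zip)
    then obtain us vs where zs: "zs = us @ (ks ! i, i) # vs" by (meson split_list)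
    show ?thesis
      using i by (simp add: m_def zs lookup_add lookup_multilinear lookup_single)
  qed
  hence T: "{i. i < ?n \<and> Poly_Mapping.lookup m i \<ge> 2} = {..<?n}" by auto
  show ?thesis
  proof (rule that[OF m])
    fix ls assume ls: "m \<in> Poly_Mapping.keys (multilinear_image ls ?n)" "length ls \<le> ?n"
    \<comment> \<open>All \<open>?n\<close> variables were hit, so \<open>ls\<close> has length
      exactly \<open>?n\<close> and the case of equality applies to both words.\<close>
    have "image_mset (\<lambda>k. k + 2) (mset ls) = image_mset (\<lambda>k. k + 2) (mset ks)"
      using keys_multilinear_image_constraint[OF m] keys_multilinear_image_constraint[OF ls(1)] ls(2)
      unfolding T by simp
    thus "mset ls = mset ks"
      by (rule multiset.inj_map_strong[rotated]) simp
  qed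
qed

section \<open>Linear independence of the Poincare-Birkhoff-Witt monomials\<close>

text \<open>Indexing by multisets turns the commutative product of monomials into the sum of their
  indices.\<close>

definition pbw :: "nat multiset \<Rightarrow> dyadic_steenrod_Q" where
  "pbw M = word (sorted_list_of_multiset M)"

text \<open>Among the monomials with non-zero coefficient take a longest one and test at the
  monomial separating it: no other word in the relation produces that monomial.\<close>

lemma pbw_independent:
  assumes "finite S" "(\<Sum>M\<in>S. scalar (c M) (pbw M)) = 0" "M \<in> S"
  shows "c M = 0"
proof (rule ccontr)
  define S' where "S' = {M\<in>S. c M \<noteq> 0}"
  assume "c M \<noteq> 0"
  hence "finite S'" "S' \<noteq> {}" using assms by (auto simp: S'_def)
  hence "finite (size ` S')" "size ` S' \<noteq> {}" by auto
  then obtain N where N: "N \<in> S'" "size N = Max (size ` S')"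
    using Max_in[of "size ` S'"] by (metis imageE)
  have max: "size K \<le> size N" if "K \<in> S'" for K
    using that N(2) \<open>finite S'\<close> by simp
  have len: "length (sorted_list_of_multiset K) = size K" for K :: "nat multiset"
    by (metis mset_sorted_list_of_multiset size_mset)
  obtain m where m: "m \<in> Poly_Mapping.keys (multilinear_image (sorted_list_of_multiset N) (size N))"
    "\<And>ls. m \<in> Poly_Mapping.keys (multilinear_image ls (size N)) \<Longrightarrow> length ls \<le> size N \<Longrightarrow> mset ls = N"
    using multilinear_separates[of "sorted_list_of_multiset N"] by (auto simp: len)
  let ?p = "Poly_Mapping.single (multilinear (size N)) 1"
  have coef: "coef ?p m (pbw K) =
      num_of_int (Poly_Mapping.lookup (multilinear_image (sorted_list_of_multiset K) (size N)) m)" for K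
    unfolding pbw_def multilinear_image_def by (rule coef_represents[OF represents_word])
  have "0 = coef ?p m (\<Sum>M\<in>S. scalar (c M) (pbw M))"
    using coef_scalar[of ?p m 0 0] by (simp add: assms(2))
  also have "\<dots> = (\<Sum>M\<in>S. c M * coef ?p m (pbw M))"
    by (simp add: coef_sum coef_scalar)
  also have "\<dots> = (\<Sum>M\<in>{N}. c M * coef ?p m (pbw M))"
  proof (rule sum.mono_neutral_right)
    show "\<forall>K\<in>S - {N}. c K * coef ?p m (pbw K) = 0"
    proof
      fix K assume K: "K \<in> S - {N}"
      show "c K * coef ?p m (pbw K) = 0"
      proof (cases "K \<in> S'")
        case True
        hence "m \<notin> Poly_Mapping.keys (multilinear_image (sorted_list_of_multiset K) (size N))"
          using m(2)[of "sorted_list_of_multiset K"] max[OF True] K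
          by (metis DiffE len mset_sorted_list_of_multiset singletonI)
        thus ?thesis by (simp add: coef in_keys_iff num_of_int_simps)
      next
        case False
        thus ?thesis using K by (simp add: S'_def)
      qed
    qed
  next
    show "{N} \<subseteq> S" using N(1) by (simp add: S'_def)
  qed (rule assms(1))
  finally have "coef ?p m (pbw N) = 0" using N(1) by (simp add: S'_def)
  thus False using m(1) by (simp add: coef in_keys_iff)
qed

lemma inj_pbw: "inj pbw"
proof (rule injI, rule ccontr)
  fix M N assume *: "pbw M = pbw N" "M \<noteq> N"
  have "(\<Sum>K\<in>{M, N}. scalar (if K = M then 1 else - 1) (pbw K)) = 0"
    using * by simp
  from pbw_independent[OF _ this, of M] show False by simp
qed

lemma independent_pbw: "Q.independent (range pbw)"
proof
  assume "Q.dependent (range pbw)"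
  then obtain t u v where t: "finite t" "t \<subseteq> range pbw" "(\<Sum>v\<in>t. scalar (u v) v) = 0" "v \<in> t" "u v \<noteq> 0"
    unfolding Q.dependent_explicit by blast
  from t(1,2) obtain S where S: "finite S" "t = pbw ` S"
    by (meson finite_subset_image subset_UNIV)
  have "(\<Sum>M\<in>S. scalar (u (pbw M)) (pbw M)) = 0"
    using t(3) unfolding S(2) by (subst (asm) sum.reindex) (auto intro: inj_on_subset[OF inj_pbw])
  from pbw_independent[OF S(1) this] show False using t(4,5) S(2) by blast
qed

section \<open>Reordering words\<close>

definition weight :: "nat multiset \<Rightarrow> nat" where
  "weight M = (\<Sum>k\<in>#M. max 1 k)"

lemma weight_simps [simp]:
  "weight {#} = 0" "weight (add_mset k M) = max 1 k + weight M" "weight (M + N) = weight M + weight N"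
  by (simp_all add: weight_def)

definition words :: "nat \<Rightarrow> nat \<Rightarrow> nat list set" where
  "words j r = {ks. j \<le> weight (mset ks) \<and> length ks < r}"

lemma witt_mult_span_words:
  assumes "x \<in> Q.span (word ` words j r)"
  shows "witt k * x \<in> Q.span (word ` words (max 1 k + j) (Suc r))"
proof (rule span_mult[OF _ assms])
  show "witt k \<in> Q.span {witt k}" by (simp add: Q.span_base)
  fix s t assume "s \<in> {witt k}" "t \<in> word ` words j r"
  then obtain ks where "ks \<in> words j r" "s * t = word (k # ks)" by auto
  thus "s * t \<in> Q.span (word ` words (max 1 k + j) (Suc r))"
    by (auto simp: words_def simp del: word_simps intro!: Q.span_base)
qed

text \<open>Moving \<open>k\<close> past a smaller \<open>u\<close> costs a multiple of
  \<open>witt (k + u + 1)\<close>, one letter in place of two, without loss of weight.\<close>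

lemma word_insort:
  "word (k # ks) - word (insort k ks)
    \<in> Q.span (word ` words (weight (mset (k # ks))) (length (k # ks)))"
proof (induction ks)
  case (Cons u us)
  show ?case
  proof (cases "k \<le> u")
    case False
    let ?V = "Q.span (word ` words (weight (mset (k # u # us))) (length (k # u # us)))"
    have "witt k * witt u - witt u * witt k = scalar (of_int (int u - int k)) (witt (k + u + 1))"
      by (rule witt_commutator)
    hence "word (k # u # us) - word (u # k # us) =
        scalar (of_int (int u - int k)) (word ((k + u + 1) # us))"
      by (simp flip: mult.assoc scalar_mult_left left_diff_distrib)
    \<comment> \<open>From \<open>k > u\<close> follow \<open>k \<ge> 1\<close> and
      \<open>k + u + 1 \<ge> max 1 k + max 1 u\<close>. Two letters \<open>0\<close> would violate
      this bound, but equal letters are never exchanged.\<close>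
    also have "\<dots> \<in> ?V"
      using False by (intro Q.span_scale Q.span_base imageI) (auto simp: words_def)
    finally have 1: "word (k # u # us) - word (u # k # us) \<in> ?V" .
    have 2: "witt u * (word (k # us) - word (insort k us)) \<in> ?V"
      using witt_mult_span_words[OF Cons.IH, of u] by (simp add: add_ac)
    have "word (k # u # us) - word (insort k (u # us)) =
        (word (k # u # us) - word (u # k # us)) + witt u * (word (k # us) - word (insort k us))"
      using False by (simp add: right_diff_distrib)
    thus ?thesis using Q.span_add[OF 1 2] by (simp only:)
  qed (simp add: Q.span_zero)
qed (simp add: Q.span_zero)

text \<open>Insertion sort: the tail is sorted first, then \<open>word_insort\<close> places the
  head; both errors obey the bounds on weight and length.\<close>

lemma word_sort: "word ks - word (sort ks) \<in> Q.span (word ` words (weight (mset ks)) (length ks))"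
proof (induction ks)
  case (Cons k ks)
  let ?V = "Q.span (word ` words (weight (mset (k # ks))) (length (k # ks)))"
  have 1: "witt k * (word ks - word (sort ks)) \<in> ?V"
    using witt_mult_span_words[OF Cons.IH, of k] by simp
  have 2: "word (k # sort ks) - word (insort k (sort ks)) \<in> ?V"
    using word_insort[of k "sort ks"] by simp
  have "word (k # ks) - word (sort (k # ks)) =
      witt k * (word ks - word (sort ks)) + (word (k # sort ks) - word (insort k (sort ks)))"
    by (simp add: right_diff_distrib)
  thus ?case using Q.span_add[OF 1 2] by (simp only:)
qed (simp add: Q.span_zero)

definition lower :: "nat \<Rightarrow> nat \<Rightarrow> nat multiset set" where
  "lower j r = {M. j \<le> weight M \<and> size M < r}"

text \<open>Induction on the length succeeds because sorting leaves only strictly shorter words as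
  errors.\<close>

lemma word_in_span_lower: "ks \<in> words j r \<Longrightarrow> word ks \<in> Q.span (pbw ` lower j r)"
proof (induction "length ks" arbitrary: ks j r rule: less_induct)
  case less
  have "word ` words (weight (mset ks)) (length ks) \<subseteq> Q.span (pbw ` lower j r)"
    using less by (auto simp: words_def)
  hence "word ks - word (sort ks) \<in> Q.span (pbw ` lower j r)"
    using Q.span_minimal[OF _ Q.subspace_span] word_sort by blast
  moreover have "word (sort ks) = pbw (mset ks)"
    by (simp add: pbw_def sorted_list_of_multiset_mset)
  hence "word (sort ks) \<in> Q.span (pbw ` lower j r)"
    using less.prems by (auto simp: words_def lower_def intro!: Q.span_base)
  ultimately have "word ks - word (sort ks) + word (sort ks) \<in> Q.span (pbw ` lower j r)"
    by (rule Q.span_add)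
  thus ?case by simp
qed

text \<open>Concatenating the two ordered words and sorting yields \<open>pbw (M + N)\<close>; the
  errors of sorting are then rewritten in ordered monomials.\<close>

lemma pbw_mult:
  "pbw M * pbw N - pbw (M + N) \<in> Q.span (pbw ` lower (weight M + weight N) (size M + size N))"
proof -
  define ks where "ks = sorted_list_of_multiset M @ sorted_list_of_multiset N"
  have mset: "mset ks = M + N" by (simp add: ks_def)
  hence len: "length ks = size M + size N" by (metis size_mset size_union)
  have "word ` words (weight (mset ks)) (length ks) \<subseteq>
      Q.span (pbw ` lower (weight (mset ks)) (length ks))"
    using word_in_span_lower by blast
  hence "word ks - word (sort ks) \<in> Q.span (pbw ` lower (weight (mset ks)) (length ks))"
    using Q.span_minimal[OF _ Q.subspace_span] word_sort by blast
  moreover have "word ks = pbw M * pbw N" by (simp add: ks_def pbw_def)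
  moreover have "word (sort ks) = pbw (M + N)"
    by (simp add: pbw_def sorted_list_of_multiset_mset flip: mset)
  ultimately show ?thesis by (simp add: mset len)
qed

lemma span_pbw: "Q.span (range pbw) = UNIV"
proof -
  have "word ks \<in> Q.span (range pbw)" for ks
    using word_in_span_lower[of ks 0 "Suc (length ks)"] Q.span_mono[of "pbw ` _" "range pbw"]
    by (auto simp: words_def)
  hence "range word \<subseteq> Q.span (range pbw)" by blast
  from Q.span_minimal[OF this Q.subspace_span] show ?thesis
    by (auto simp: span_word)
qed

section \<open>Coordinates and leading terms\<close>

definition coord :: "dyadic_steenrod_Q \<Rightarrow> nat multiset \<Rightarrow> dyadic_num" where
  "coord x M = Q.representation (range pbw) x (pbw M)"

lemma coord_add: "coord (x + y) M = coord x M + coord y M"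
  by (simp add: coord_def Q.representation_add independent_pbw span_pbw)

lemma coord_scalar: "coord (scalar c x) M = c * coord x M"
  by (simp add: coord_def Q.representation_scale independent_pbw span_pbw)

lemma coord_zero [simp]: "coord 0 M = 0"
  by (simp add: coord_def Q.representation_zero)

lemma coord_sum: "coord (sum f A) M = (\<Sum>x\<in>A. coord (f x) M)"
  by (induction A rule: infinite_finite_induct) (simp_all add: coord_add)

lemma coord_pbw: "coord (pbw N) M = (if M = N then 1 else 0)"
  using inj_pbw by (simp add: coord_def Q.representation_basis independent_pbw inj_eq)

lemma finite_coord: "finite {M. coord x M \<noteq> 0}"
proof -
  have "finite (pbw -` {v. Q.representation (range pbw) x v \<noteq> 0})"
    by (intro finite_vimageI Q.finite_representation inj_pbw)
  thus ?thesis by (simp add: coord_def vimage_def)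
qed

lemma coord_expansion: "x = (\<Sum>M | coord x M \<noteq> 0. scalar (coord x M) (pbw M))"
proof -
  let ?r = "Q.representation (range pbw) x"
  have "{v. ?r v \<noteq> 0} = pbw ` {M. coord x M \<noteq> 0}"
    using Q.representation_ne_zero[of "range pbw" x] by (auto simp: coord_def)
  moreover have "(\<Sum>v | ?r v \<noteq> 0. scalar (?r v) v) = x"
    by (rule Q.sum_nonzero_representation_eq) (simp_all add: independent_pbw span_pbw)
  ultimately show ?thesis
    by (simp add: sum.reindex[OF inj_on_subset[OF inj_pbw]] coord_def)
qed

lemma span_pbw_iff: "x \<in> Q.span (pbw ` S) \<longleftrightarrow> (\<forall>M. coord x M \<noteq> 0 \<longrightarrow> M \<in> S)"
proof
  assume "x \<in> Q.span (pbw ` S)"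
  thus "\<forall>M. coord x M \<noteq> 0 \<longrightarrow> M \<in> S"
    by (induction rule: Q.span_induct_alt)
      (auto simp: coord_add coord_scalar coord_pbw split: if_splits)
next
  assume *: "\<forall>M. coord x M \<noteq> 0 \<longrightarrow> M \<in> S"
  show "x \<in> Q.span (pbw ` S)"
    by (subst coord_expansion, rule Q.span_sum)
      (use * in \<open>auto intro!: Q.span_scale intro: Q.span_base\<close>)
qed

text \<open>Negating the size puts longer monomials first; the multiset order breaks the remaining
  ties, so that distinct monomials have distinct keys.\<close>

definition key :: "nat multiset \<Rightarrow> nat \<times> int \<times> nat multiset" where
  "key M = (weight M, - int (size M), M)"

definition leads :: "nat multiset \<Rightarrow> dyadic_steenrod_Q \<Rightarrow> bool" where
  "leads M x \<longleftrightarrow> coord x M \<noteq> 0 \<and> (\<forall>N. coord x N \<noteq> 0 \<longrightarrow> key M \<le> key N)"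

lemma leads_exists:
  assumes "x \<noteq> 0"
  obtains M where "leads M x"
proof -
  let ?S = "{M. coord x M \<noteq> 0}"
  have "?S \<noteq> {}" using assms coord_expansion[of x] by (metis sum.empty)
  hence "Min (key ` ?S) \<in> key ` ?S" by (intro Min_in) (simp_all add: finite_coord)
  then obtain M where M: "coord x M \<noteq> 0" "key M = Min (key ` ?S)" by auto
  have "key M \<le> key N" if "coord x N \<noteq> 0" for N
    unfolding M(2) using that by (intro Min_le) (auto simp: finite_coord)
  thus ?thesis using M(1) that by (auto simp: leads_def)
qed

text \<open>Weight and size are additive, so both must agree factor by factor. There remains the
  multiset order, in which addition is strictly monotone.\<close>

lemma key_le_sum_eq:
  assumes "key M \<le> key M'" "key N \<le> key N'" "M' + N' = M + N"
  shows "M' = M \<and> N' = N"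
proof -
  have "weight M' + weight N' = weight M + weight N" "size M' + size N' = size M + size N"
    using assms(3) by (metis weight_simps(3), metis size_union)
  hence "M \<le> M'" "N \<le> N'"
    using assms(1,2) by (auto simp: key_def less_eq_prod_def)
  thus ?thesis
    using assms(3) by (metis add_less_le_mono add_le_less_mono order_less_le)
qed

text \<open>If \<open>M' + N'\<close> does not outweigh \<open>M + N\<close>, all weights agree and
  \<open>M'\<close>, \<open>N'\<close> are no longer than \<open>M\<close>, \<open>N\<close>. Hence
  the corrections to \<open>pbw M' * pbw N'\<close> miss \<open>M + N\<close>.\<close>

lemma key_le_sum_not_lower:
  assumes "key M \<le> key M'" "key N \<le> key N'"
  shows "M + N \<notin> lower (weight M' + weight N') (size M' + size N')"
  using assms by (auto simp: key_def less_eq_prod_def lower_def)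

text \<open>In the product of the two expansions, only the pair \<open>M\<close>, \<open>N\<close>
  reaches \<open>M + N\<close>: other sums differ from it, and no correction term gets
  there.\<close>

lemma coord_mult_leads:
  assumes "leads M x" "leads N y"
  shows "coord (x * y) (M + N) = coord x M * coord y N"
proof -
  let ?S = "{M. coord x M \<noteq> 0}" and ?T = "{N. coord y N \<noteq> 0}"
  have *: "coord (pbw M' * pbw N') (M + N) = (if M' = M then if N' = N then 1 else 0 else 0)"
    if "M' \<in> ?S" "N' \<in> ?T" for M' N'
  proof -
    have keys: "key M \<le> key M'" "key N \<le> key N'"
      using that assms by (auto simp: leads_def)
    have "coord (pbw M' * pbw N' - pbw (M' + N')) (M + N) = 0"
      using pbw_mult[of M' N'] key_le_sum_not_lower[OF keys] unfolding span_pbw_iff by blast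
    hence "coord (pbw M' * pbw N') (M + N) = coord (pbw (M' + N')) (M + N)"
      using coord_add[of "pbw M' * pbw N' - pbw (M' + N')" "pbw (M' + N')" "M + N"] by simp
    thus ?thesis
      using key_le_sum_eq[OF keys] by (auto simp: coord_pbw)
  qed
  have "x * y = (\<Sum>M'\<in>?S. \<Sum>N'\<in>?T. scalar (coord x M') (scalar (coord y N') (pbw M' * pbw N')))"
    by (subst coord_expansion[of x], subst coord_expansion[of y])
      (simp add: sum_product scalar_mult_left scalar_mult_right mult.commute)
  also have "coord \<dots> (M + N) =
      (\<Sum>M'\<in>?S. \<Sum>N'\<in>?T. coord x M' * (coord y N' * coord (pbw M' * pbw N') (M + N)))"
    by (simp only: coord_sum coord_scalar)
  also have "\<dots> = (\<Sum>M'\<in>?S. \<Sum>N'\<in>?T.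
      if M' = M then if N' = N then coord x M * coord y N else 0 else 0)"
    by (rule sum.cong[OF HOL.refl], rule sum.cong[OF HOL.refl], simp only: *) simp
  also have "\<dots> = (\<Sum>M'\<in>?S. if M' = M then coord x M * coord y N else 0)"
    using assms by (intro sum.cong refl) (auto simp: sum.delta finite_coord leads_def)
  also have "\<dots> = coord x M * coord y N"
    using assms by (simp add: sum.delta finite_coord leads_def)
  finally show ?thesis .
qed

section \<open>The filtration by weight\<close>

definition weight_filtration :: "nat \<Rightarrow> dyadic_steenrod_Q set" where
  "weight_filtration j = Q.span (pbw ` {M. j \<le> weight M})"

lemma mem_weight_filtration_iff:
  "x \<in> weight_filtration j \<longleftrightarrow> (\<forall>M. coord x M \<noteq> 0 \<longrightarrow> j \<le> weight M)"
  by (simp add: weight_filtration_def span_pbw_iff)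

lemma weight_filtration_add:
  "x \<in> weight_filtration j \<Longrightarrow> y \<in> weight_filtration j \<Longrightarrow> x + y \<in> weight_filtration j"
  by (simp add: weight_filtration_def Q.span_add)

lemma weight_filtration_mult:
  assumes "x \<in> weight_filtration i" "y \<in> weight_filtration j"
  shows "x * y \<in> weight_filtration (i + j)"
  unfolding weight_filtration_def
proof (rule span_mult[OF assms[unfolded weight_filtration_def]])
  fix s t assume "s \<in> pbw ` {M. i \<le> weight M}" "t \<in> pbw ` {M. j \<le> weight M}"
  then obtain M N where MN: "s = pbw M" "t = pbw N" "i \<le> weight M" "j \<le> weight N"
    by auto
  let ?V = "Q.span (pbw ` {M. i + j \<le> weight M})"
  have "pbw (M + N) \<in> ?V"
    using MN by (intro Q.span_base) auto
  moreover have "pbw M * pbw N - pbw (M + N) \<in> ?V"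
    using pbw_mult[of M N] MN(3,4) unfolding span_pbw_iff by (force simp: lower_def)
  ultimately have "pbw M * pbw N - pbw (M + N) + pbw (M + N) \<in> ?V"
    by (rule Q.span_add[rotated])
  thus "s * t \<in> ?V" by (simp add: MN)
qed

section \<open>The powers of the ideal are the steps of the filtration\<close>

lemma ring_of_type_algebra_simps [simp]:
  "carrier ring_of_type_algebra = UNIV"
  "x \<otimes>\<^bsub>ring_of_type_algebra\<^esub> y = x * y"
  "x \<oplus>\<^bsub>ring_of_type_algebra\<^esub> y = x + y"
  "\<zero>\<^bsub>ring_of_type_algebra\<^esub> = 0"
  by (simp_all add: ring_of_type_algebra_def)

interpretation R: Ring.ring steenrod_Q_ring
  by (rule ring_steenrod_Q_ring)

lemma ideal_steenrod_Q_I: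
  assumes "0 \<in> I" "\<And>x y. x \<in> I \<Longrightarrow> y \<in> I \<Longrightarrow> x + y \<in> I"
    "\<And>x y. x \<in> I \<Longrightarrow> y * x \<in> I" "\<And>x y. x \<in> I \<Longrightarrow> x * y \<in> I"
  shows "ideal I steenrod_Q_ring"
proof (rule idealI)
  have neg: "- x \<in> I" if "x \<in> I" for x
    using assms(3)[OF that, of "- 1"] by simp
  have "inv\<^bsub>add_monoid steenrod_Q_ring\<^esub> x = - x" for x
    using R.minus_equality[of "- x" x] by (simp add: a_inv_def)
  thus "subgroup I (add_monoid steenrod_Q_ring)"
    using assms(1,2) neg by (intro subgroup.intro) auto
qed (use assms in \<open>auto intro: R.ring_axioms\<close>)

lemma ideal_weight_filtration: "ideal (weight_filtration j) steenrod_Q_ring"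
proof (rule ideal_steenrod_Q_I)
  fix x y :: dyadic_steenrod_Q
  assume x: "x \<in> weight_filtration j"
  \<comment> \<open>Step 0 is the whole algebra, so multiplicativity of the filtration gives closure
    on both sides.\<close>
  have y: "y \<in> weight_filtration 0" by (simp add: mem_weight_filtration_iff)
  show "y * x \<in> weight_filtration j" "x * y \<in> weight_filtration j"
    using weight_filtration_mult[OF y x] weight_filtration_mult[OF x y] by simp_all
qed (simp add: mem_weight_filtration_iff, rule weight_filtration_add)

lemma witt_in_weight_filtration: "witt k \<in> weight_filtration (max 1 k)"
proof -
  have "witt k = pbw {#k#}" by (simp add: pbw_def)
  thus ?thesis by (simp add: mem_weight_filtration_iff coord_pbw)
qed

lemma Jq_op_2_eq: "tensor (Jq_op 2) 1 = scalar (inverse 2) (witt 0 * witt 0) - witt 1"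
  by simp

lemma J_plus_subset: "J_plus \<subseteq> weight_filtration 1"
  unfolding J_plus_def
proof (rule R.genideal_minimal[OF ideal_weight_filtration])
  have witt: "witt 0 \<in> weight_filtration 1" "witt 1 \<in> weight_filtration 1"
    using witt_in_weight_filtration[of 0] witt_in_weight_filtration[of 1] by simp_all
  moreover have "witt 0 * witt 0 \<in> weight_filtration 1"
    using ideal.I_l_closed[OF ideal_weight_filtration witt(1)] by simp
  ultimately have "tensor (Jq_op 2) 1 \<in> weight_filtration 1"
    unfolding Jq_op_2_eq weight_filtration_def by (intro Q.span_diff Q.span_scale)
  thus "{tensor (Jq_op 1) 1, tensor (Jq_op 2) 1} \<subseteq> weight_filtration 1"
    using witt by simp
qed

lemma ideal_J_plus: "ideal J_plus steenrod_Q_ring"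
  unfolding J_plus_def by (rule R.genideal_ideal) simp

lemma ideal_J_plus_power: "ideal (J_plus_power j) steenrod_Q_ring"
proof (induction j)
  case 0
  show ?case using R.oneideal by (simp add: J_plus_power_simps)
next
  case (Suc j)
  show ?case unfolding J_plus_power_simps by (rule R.ideal_prod_is_ideal[OF Suc ideal_J_plus])
qed

lemma J_plus_power_closed:
  "0 \<in> J_plus_power j"
  "x \<in> J_plus_power j \<Longrightarrow> y \<in> J_plus_power j \<Longrightarrow> x + y \<in> J_plus_power j"
  "x \<in> J_plus_power j \<Longrightarrow> y \<in> J_plus_power j \<Longrightarrow> x - y \<in> J_plus_power j"
  "x \<in> J_plus_power j \<Longrightarrow> y * x \<in> J_plus_power j"
  "x \<in> J_plus_power j \<Longrightarrow> x * y \<in> J_plus_power j"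
  "x \<in> J_plus_power j \<Longrightarrow> scalar q x \<in> J_plus_power j"
proof -
  note ideal = ideal_J_plus_power[of j]
  show add: "x + y \<in> J_plus_power j" if "x \<in> J_plus_power j" "y \<in> J_plus_power j" for x y
    using additive_subgroup.a_closed[OF ideal.axioms(1)[OF ideal] that] by simp
  show "0 \<in> J_plus_power j"
    using additive_subgroup.zero_closed[OF ideal.axioms(1)[OF ideal]] by simp
  show left: "y * x \<in> J_plus_power j" if "x \<in> J_plus_power j" for x y
    using ideal.I_l_closed[OF ideal that, of y] by simp
  show "x * y \<in> J_plus_power j" if "x \<in> J_plus_power j" for x y
    using ideal.I_r_closed[OF ideal that, of y] by simp
  show "scalar q x \<in> J_plus_power j" if "x \<in> J_plus_power j" for x
    unfolding scalar_def by (rule left[OF that])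
  show "x - y \<in> J_plus_power j" if "x \<in> J_plus_power j" "y \<in> J_plus_power j" for x y
    using add[OF that(1) left[OF that(2), of "- 1"]] by simp
qed

lemma J_plus_power_1: "J_plus_power 1 = J_plus"
proof -
  have "J_plus_power 1 \<subseteq> J_plus"
    using R.ideal_prod_inter[OF R.oneideal ideal_J_plus] by (simp add: J_plus_power_simps)
  moreover have "x \<in> J_plus_power 1" if "x \<in> J_plus" for x
    using ideal_prod.prod[of 1 UNIV x J_plus steenrod_Q_ring] that by (simp add: J_plus_power_simps)
  ultimately show ?thesis by blast
qed

text \<open>Powers grow by one factor on the right; induction on \<open>j\<close> moves
  \<open>x\<close> inwards by associativity.\<close>

lemma J_plus_power_mult:
  assumes "x \<in> J_plus_power i" "y \<in> J_plus_power j"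
  shows "x * y \<in> J_plus_power (i + j)"
  using assms(2)
proof (induction j arbitrary: y)
  case 0
  show ?case using J_plus_power_closed(5)[OF assms(1)] by simp
next
  case (Suc j)
  from Suc.prems have "y \<in> ideal_prod steenrod_Q_ring (J_plus_power j) J_plus"
    by (simp add: J_plus_power_simps)
  thus ?case
  proof induction
    case (prod s t)
    have "(x * s) * t \<in> ideal_prod steenrod_Q_ring (J_plus_power (i + j)) J_plus"
      using ideal_prod.prod[OF Suc.IH[OF prod(1)] prod(2), of steenrod_Q_ring] by simp
    thus ?case by (simp add: J_plus_power_simps mult.assoc)
  next
    case (sum s t)
    thus ?case using J_plus_power_closed(2) by (simp add: distrib_left)
  qed
qed

lemma J_plus_power_antimono: "i \<le> j \<Longrightarrow> J_plus_power j \<subseteq> J_plus_power i"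
proof (induction rule: dec_induct)
  case (step j)
  have "J_plus_power (Suc j) \<subseteq> J_plus_power j"
    using R.ideal_prod_inter[OF ideal_J_plus_power ideal_J_plus] by (simp add: J_plus_power_simps)
  thus ?case using step by blast
qed simp

text \<open>\<open>witt 1\<close> lies in the first power along with \<open>Jq^1\<close> and
  \<open>Jq^2\<close>; each later bracket with \<open>witt 0\<close> gains one power.\<close>

lemma witt_in_J_plus_power: "witt k \<in> J_plus_power (max 1 k)"
proof -
  have "{tensor (Jq_op 1) 1, tensor (Jq_op 2) 1} \<subseteq> J_plus"
    unfolding J_plus_def by (rule R.genideal_self) simp
  hence Jq: "tensor (Jq_op 1) 1 \<in> J_plus_power 1" "tensor (Jq_op 2) 1 \<in> J_plus_power 1"
    by (simp_all only: J_plus_power_1 insert_subset)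
  have 0: "witt 0 \<in> J_plus_power 1" using Jq by simp
  have "witt (Suc k) \<in> J_plus_power (Suc k)" for k
  proof (induction k)
    case 0
    show ?case using Jq J_plus_power_closed by simp
  next
    case (Suc k)
    show ?case
      using J_plus_power_mult[OF 0 Suc] J_plus_power_mult[OF Suc 0]
      by (simp add: J_plus_power_closed)
  qed
  thus ?thesis using 0 by (cases k) simp_all
qed

lemma word_in_J_plus_power: "word ks \<in> J_plus_power (weight (mset ks))"
proof (induction ks)
  case Nil
  show ?case by (simp add: J_plus_power_simps)
next
  case (Cons k ks)
  show ?case using J_plus_power_mult[OF witt_in_J_plus_power Cons] by simp
qed

text \<open>One inclusion holds since the ideal lies in step 1 of a multiplicative filtration; for
  the other, each letter of a monomial contributes its own weight to the power.\<close>

lemma J_plus_power_eq_weight_filtration: "J_plus_power j = weight_filtration j"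
proof
  show "J_plus_power j \<subseteq> weight_filtration j"
  proof (induction j)
    case 0
    show ?case by (auto simp: mem_weight_filtration_iff)
  next
    case (Suc j)
    have "x \<in> weight_filtration (Suc j)"
      if "x \<in> ideal_prod steenrod_Q_ring (J_plus_power j) J_plus" for x
      using that
    proof induction
      case (prod s t)
      thus ?case using weight_filtration_mult[of s j t 1] Suc J_plus_subset by auto
    next
      case (sum s t)
      thus ?case using weight_filtration_add by simp
    qed
    thus ?case by (auto simp: J_plus_power_simps)
  qed
  show "weight_filtration j \<subseteq> J_plus_power j"
  proof
    fix x assume "x \<in> weight_filtration j"
    thus "x \<in> J_plus_power j" unfolding weight_filtration_def
    proof (induction rule: Q.span_induct_alt)
      case (step c s z)
      then obtain M where M: "j \<le> weight M" "s = pbw M" by auto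
      have "pbw M \<in> J_plus_power (weight M)"
        using word_in_J_plus_power[of "sorted_list_of_multiset M"] by (simp add: pbw_def)
      hence "s \<in> J_plus_power j" using M J_plus_power_antimono by blast
      thus ?case using step.IH by (intro J_plus_power_closed)
    qed (rule J_plus_power_closed)
  qed
qed

section \<open>The norm read off from leading monomials\<close>

text \<open>The powers containing \<open>x\<close> are exactly those up to \<open>weight M\<close>,
  so the greatest exponent exists.\<close>

lemma adem_norm_eq_power:
  assumes "x \<in> weight_filtration (weight M)" "coord x M \<noteq> 0"
  shows "adem_norm x = (1 / 2) ^ weight M"
proof -
  have iff: "x \<in> J_plus_power j \<longleftrightarrow> j \<le> weight M" for j
    using assms unfolding J_plus_power_eq_weight_filtration mem_weight_filtration_iff
    by (meson order.trans)
  hence "\<not> (\<forall>j. x \<in> J_plus_power j)" by (metis Suc_n_not_le_n)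
  moreover have "(GREATEST j. x \<in> J_plus_power j) = weight M"
    by (rule Greatest_equality) (simp_all add: iff)
  ultimately show ?thesis unfolding adem_norm_def by simp
qed

lemma leads_weight_filtration: "leads M x \<Longrightarrow> x \<in> weight_filtration (weight M)"
  unfolding mem_weight_filtration_iff leads_def key_def less_eq_prod_def by force

lemma adem_norm_leads: "leads M x \<Longrightarrow> adem_norm x = (1 / 2) ^ weight M"
  using adem_norm_eq_power leads_weight_filtration by (simp add: leads_def)

lemma adem_norm_0: "adem_norm 0 = 0"
  by (simp add: adem_norm_def J_plus_power_closed(1))

text \<open>The leading monomial has finite weight, so no non-zero element lies in all powers of the
  ideal.\<close>

lemma adem_norm_pos:
  assumes "x \<noteq> 0"
  shows "adem_norm x > 0"
proof -
  obtain M where "leads M x" using assms by (rule leads_exists)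
  thus ?thesis by (simp add: adem_norm_leads)
qed

lemma adem_norm_nonneg: "adem_norm x \<ge> 0"
  using adem_norm_pos[of x] adem_norm_0 by (cases "x = 0") simp_all

text \<open>The filtration bounds the order of the product from below. The bound is attained at
  \<open>M + N\<close>, where the coordinate is a product of non-zero elements of a field.\<close>

lemma adem_norm_mult: "adem_norm (x * y) = adem_norm x * adem_norm y"
proof (cases "x = 0 \<or> y = 0")
  case False
  then obtain M N where M: "leads M x" and N: "leads N y"
    by (metis leads_exists)
  have "x * y \<in> weight_filtration (weight (M + N))"
    using weight_filtration_mult[OF M[THEN leads_weight_filtration] N[THEN leads_weight_filtration]]
    by simp
  moreover have "coord (x * y) (M + N) \<noteq> 0"
    using M N by (simp add: coord_mult_leads) (simp add: leads_def)
  ultimately have "adem_norm (x * y) = (1 / 2) ^ weight (M + N)"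
    by (rule adem_norm_eq_power)
  thus ?thesis by (simp add: adem_norm_leads[OF M] adem_norm_leads[OF N] power_add)
qed (auto simp: adem_norm_0)

lemma power_weight_le_adem_norm:
  assumes "coord x M \<noteq> 0"
  shows "(1 / 2) ^ weight M \<le> adem_norm x"
proof -
  have "x \<noteq> 0" using assms by auto
  then obtain N where N: "leads N x" by (rule leads_exists)
  hence "weight N \<le> weight M"
    using leads_weight_filtration[OF N] assms by (simp add: mem_weight_filtration_iff)
  thus ?thesis by (simp add: adem_norm_leads[OF N] power_decreasing)
qed

lemma adem_norm_triangle: "adem_norm (x + y) \<le> adem_norm x + adem_norm y"
proof (cases "x + y = 0")
  case False
  then obtain M where M: "leads M (x + y)" by (rule leads_exists)
  \<comment> \<open>The leading monomial of the sum occurs in a summand, whose norm is then at least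
    as large.\<close>
  hence "coord x M \<noteq> 0 \<or> coord y M \<noteq> 0"
    by (auto simp: leads_def coord_add)
  thus ?thesis
    using power_weight_le_adem_norm[of x M] power_weight_le_adem_norm[of y M]
      adem_norm_nonneg[of x] adem_norm_nonneg[of y]
    by (auto simp: adem_norm_leads[OF M])
qed (simp add: adem_norm_0 adem_norm_nonneg)

lemma adem_norm_eq_0_iff: "adem_norm x = 0 \<longleftrightarrow> x = 0"
proof (cases "x = 0")
  case False
  thus ?thesis using adem_norm_pos[OF False] by simp
qed (simp add: adem_norm_0)

theorem corollary6p3:
  fixes \<theta>\<^sub>1 \<theta>\<^sub>2 :: dyadic_steenrod_Q
  shows "multiplicative_norm adem_norm \<and>
         adem_norm (\<theta>\<^sub>1 * \<theta>\<^sub>2) = adem_norm \<theta>\<^sub>1 * adem_norm \<theta>\<^sub>2"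
  unfolding multiplicative_norm_def
  by (intro conjI allI adem_norm_nonneg adem_norm_eq_0_iff adem_norm_triangle adem_norm_mult)

end
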